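(* Consider a large financial market, i.e. a sequence of semimartingale market models $S^n$ on $(\Omega^n,\mathcal F^n,(\mathcal F^n_t)_{t\ge 0},P^n)$, $n\in\mathbb N$, such that $M^n\cap\mathbb P^n\neq\varnothing$ for all $n\in\mathbb N$. Then the following two conditions are equivalent: (1) NAMFL$^*(\mathbb U_2)$: for every $\varepsilon>0$ there exist $\delta>0$, $u\in\mathbb U_2$ and a sequence $(R^n)$ with $R^n\in\mathbb P^n$ and $(R^n)\lhd\rhd(P^n)$ such that for every sequence $(w^n)$ with $w^n\in D^{\varepsilon,n}$ for all $n$, $$\limsup_{n\to\infty}\ \sup_{f^n\in\mathbf C^n}E_{R^n}[u(f^n-w^n)]<u(0)-\delta.$$ (2) There exists a sequence of probability measures $(Q^n)$ with $Q^n\in M^n\cap\mathbb P^n$ for all $n$ such that $(Q^n)\lhd\rhd(P^n)$.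
   Context: Large financial market: for each $n\in\mathbb N$, $(\Omega^n,\mathcal F^n,(\mathcal F^n_t)_{t\in[0,\infty)},P^n)$ is a filtered probability space whose filtration satisfies the usual conditions, and $S^n=(S^n_t)_{t\in[0,\infty)}$ is an adapted $\mathbb R^{d(n)}$-valued semimartingale ($d(n)<\infty$). $\mathbb P^n$ is the set of probability measures on $(\Omega^n,\mathcal F^n)$ equivalent to $P^n$. A predictable $S^n$-integrable process $H$ is admissible if there is $a>0$ with $(H\cdot S^n)\ge -a$, where $H\cdot S^n$ is the stochastic integral. Define $$\mathbf K^n=\{(H\cdot S^n)_\infty: H\text{ admissible and }(H\cdot S^n)_\infty=\lim_{t\to\infty}(H\cdot S^n)_t\text{ exists a.s.}\},$$ $$\mathbf C^n=(\mathbf K^n-L^0_+(P^n))\cap L^\infty(P^n),$$ $$M^n=\{Q\ll P^n \text{ probability measure}:\ \mathbf K^n\subseteq L^1(Q)\text{ and }E_Q[f]\le 0\text{ for all }f\in\mathbf K^n\}.$$ For $\varepsilon>0$, $D^{\varepsilon,n}=\{w\in L^\infty(P^n):0\le w\le 1\text{ and }E_{P^n}[w]\ge\varepsilon\}$. $\mathbb U_2$ is the set of functions $u:\mathbb R\to\mathbb R$ that are nondecreasing and concave on $\mathbb R$ (finite-valued). Contiguity: $(R^n)\lhd(P^n)$ means that for all $A^n\in\mathcal F^n$, $P^n(A^n)\to 0$ implies $R^n(A^n)\to 0$. $(R^n)\lhd\rhd(P^n)$ means $(R^n)\lhd(P^n)$ and $(P^n)\lhd(R^n)$. *)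

theory Defs
  imports "HOL-Probability.Probability"
begin

text \<open>
  Conventions. Time is the half-line \<open>[0,\<infinity>)\<close>: processes and filtrations are indexed by type
  \<open>real\<close>, but only indices \<open>t \<ge> 0\<close> are ever constrained or used. An \<open>\<real>\<^sup>d\<close>-valued process is a
  function \<open>X t \<omega> j\<close> of which only the coordinates \<open>j < d\<close> matter; this lets the dimension
  \<open>d\<close> vary with the index of the market. Random variables are functions, and identities between
  elements of \<open>L\<^sup>0\<close> are almost sure identities. All stochastic integrals start at \<open>0\<close>, i.e. they
  are integrals over \<open>(0,t]\<close>.
\<close>


section \<open>Filtered probability spaces and processes\<close>

definition filtered_prob_space :: "'a measure \<Rightarrow> (real \<Rightarrow> 'a measure) \<Rightarrow> bool" where
  "filtered_prob_space P F \<longleftrightarrow>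
     prob_space P \<and>
     (\<forall>t\<ge>0. subalgebra P (F t)) \<and>
     (\<forall>s\<ge>0. \<forall>t\<ge>s. sets (F s) \<subseteq> sets (F t))"

text \<open>The usual conditions: \<open>P\<close> is complete and \<open>F 0\<close> contains all \<open>P\<close>-null sets (together: every
  subset of a \<open>P\<close>-null set lies in \<open>F 0\<close>), and the filtration is right-continuous.\<close>

definition usual_conditions :: "'a measure \<Rightarrow> (real \<Rightarrow> 'a measure) \<Rightarrow> bool" where
  "usual_conditions P F \<longleftrightarrow>
     (\<forall>N\<in>null_sets P. Pow N \<subseteq> sets (F 0)) \<and>
     (\<forall>t\<ge>0. sets (F t) = (\<Inter>s\<in>{t<..}. sets (F s)))"

definition adapted :: "(real \<Rightarrow> 'a measure) \<Rightarrow> (real \<Rightarrow> 'a \<Rightarrow> real) \<Rightarrow> bool" where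
  "adapted F X \<longleftrightarrow> (\<forall>t\<ge>0. X t \<in> borel_measurable (F t))"

definition cadlag :: "(real \<Rightarrow> real) \<Rightarrow> bool" where
  "cadlag x \<longleftrightarrow>
     (\<forall>t\<ge>0. continuous (at_right t) x) \<and>
     (\<forall>t>0. \<exists>l. (x \<longlongrightarrow> l) (at_left t))"

definition adapted_cadlag :: "'a measure \<Rightarrow> (real \<Rightarrow> 'a measure) \<Rightarrow> (real \<Rightarrow> 'a \<Rightarrow> real) \<Rightarrow> bool"
  where
  "adapted_cadlag P F X \<longleftrightarrow> adapted F X \<and> (AE \<omega> in P. cadlag (\<lambda>t. X t \<omega>))"


section \<open>Semimartingales\<close>

definition martingale :: "'a measure \<Rightarrow> (real \<Rightarrow> 'a measure) \<Rightarrow> (real \<Rightarrow> 'a \<Rightarrow> real) \<Rightarrow> bool" where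
  "martingale P F X \<longleftrightarrow>
     adapted F X \<and>
     (\<forall>t\<ge>0. integrable P (X t)) \<and>
     (\<forall>s\<ge>0. \<forall>t\<ge>s. AE \<omega> in P. real_cond_exp P (F s) (X t) \<omega> = X s \<omega>)"

text \<open>Stopping times may be infinite; the constant \<open>stopping_time\<close> of the library is not
  applicable because its index type has to coincide with the value type.\<close>

definition is_stopping_time :: "'a measure \<Rightarrow> (real \<Rightarrow> 'a measure) \<Rightarrow> ('a \<Rightarrow> ereal) \<Rightarrow> bool" where
  "is_stopping_time P F T \<longleftrightarrow>
     (\<forall>\<omega>\<in>space P. 0 \<le> T \<omega>) \<and>
     (\<forall>t\<ge>0. {\<omega> \<in> space P. T \<omega> \<le> ereal t} \<in> sets (F t))"

definition stopped :: "(real \<Rightarrow> 'a \<Rightarrow> real) \<Rightarrow> ('a \<Rightarrow> ereal) \<Rightarrow> real \<Rightarrow> 'a \<Rightarrow> real" where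
  "stopped X T = (\<lambda>t \<omega>. X (real_of_ereal (min (ereal t) (T \<omega>))) \<omega>)"

definition local_martingale ::
  "'a measure \<Rightarrow> (real \<Rightarrow> 'a measure) \<Rightarrow> (real \<Rightarrow> 'a \<Rightarrow> real) \<Rightarrow> bool" where
  "local_martingale P F X \<longleftrightarrow>
     adapted_cadlag P F X \<and>
     (\<exists>T :: nat \<Rightarrow> 'a \<Rightarrow> ereal.
        (\<forall>k. is_stopping_time P F (T k)) \<and>
        (AE \<omega> in P. incseq (\<lambda>k. T k \<omega>) \<and> (\<lambda>k. T k \<omega>) \<longlonglongrightarrow> \<infinity>) \<and>
        (\<forall>k. martingale P F (\<lambda>t \<omega>. stopped X (T k) t \<omega> - X 0 \<omega>)))"

definition locally_bounded_variation :: "(real \<Rightarrow> real) \<Rightarrow> bool" where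
  "locally_bounded_variation x \<longleftrightarrow>
     (\<forall>t\<ge>0. \<exists>B. \<forall>(m::nat) (p::nat \<Rightarrow> real).
        mono p \<and> range p \<subseteq> {0..t} \<longrightarrow> (\<Sum>i<m. \<bar>x (p (Suc i)) - x (p i)\<bar>) \<le> B)"

definition semimartingale ::
  "'a measure \<Rightarrow> (real \<Rightarrow> 'a measure) \<Rightarrow> (real \<Rightarrow> 'a \<Rightarrow> real) \<Rightarrow> bool" where
  "semimartingale P F X \<longleftrightarrow>
     adapted_cadlag P F X \<and>
     (\<exists>M A. local_martingale P F M \<and>
            adapted_cadlag P F A \<and>
            (AE \<omega> in P. locally_bounded_variation (\<lambda>t. A t \<omega>)) \<and>
            (\<forall>t\<ge>0. \<forall>\<omega>\<in>space P. X t \<omega> = M t \<omega> + A t \<omega>))"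

definition semimartingale_vec ::
  "'a measure \<Rightarrow> (real \<Rightarrow> 'a measure) \<Rightarrow> nat \<Rightarrow> (real \<Rightarrow> 'a \<Rightarrow> nat \<Rightarrow> real) \<Rightarrow> bool" where
  "semimartingale_vec P F d S \<longleftrightarrow> (\<forall>j<d. semimartingale P F (\<lambda>t \<omega>. S t \<omega> j))"


section \<open>Predictable integrands and the stochastic integral\<close>

definition predictable_algebra :: "'a measure \<Rightarrow> (real \<Rightarrow> 'a measure) \<Rightarrow> (real \<times> 'a) measure" where
  "predictable_algebra P F =
     sigma ({0..} \<times> space P)
       ({{0} \<times> A | A. A \<in> sets (F 0)} \<union>
        {{s<..t} \<times> A | s t A. 0 \<le> s \<and> s \<le> t \<and> A \<in> sets (F s)})"

definition predictable ::
  "'a measure \<Rightarrow> (real \<Rightarrow> 'a measure) \<Rightarrow> nat \<Rightarrow> (real \<Rightarrow> 'a \<Rightarrow> nat \<Rightarrow> real) \<Rightarrow> bool" where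
  "predictable P F d H \<longleftrightarrow>
     (\<forall>j<d. (\<lambda>(t, \<omega>). H t \<omega> j) \<in> borel_measurable (predictable_algebra P F))"

text \<open>\<open>elementary_integral P F d S H Y\<close>: \<open>H\<close> is the bounded elementary predictable integrand
  \<open>H = \<xi>0 1\<^bsub>{0}\<^esub> + (\<Sum>i<m. \<xi> i 1\<^bsub>(a i, b i]\<^esub>)\<close>
  with \<open>\<xi>0\<close> being \<open>F 0\<close>- and \<open>\<xi> i\<close> being \<open>F (a i)\<close>-measurable, \<open>\<real>\<^sup>d\<close>-valued and bounded, and
  \<open>Y\<close> is its integral
  \<open>Y r = (\<Sum>i<m. \<xi> i \<bullet> (S (r \<and> b i) - S (r \<and> a i)))\<close>. The intervals need not be disjoint.\<close>

definition bounded_rv :: "'a measure \<Rightarrow> 'a measure \<Rightarrow> ('a \<Rightarrow> real) \<Rightarrow> bool" where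
  "bounded_rv P G \<xi> \<longleftrightarrow> \<xi> \<in> borel_measurable G \<and> (\<exists>c. \<forall>\<omega>\<in>space P. \<bar>\<xi> \<omega>\<bar> \<le> c)"

definition elementary_integral ::
  "'a measure \<Rightarrow> (real \<Rightarrow> 'a measure) \<Rightarrow> nat \<Rightarrow> (real \<Rightarrow> 'a \<Rightarrow> nat \<Rightarrow> real) \<Rightarrow>
   (real \<Rightarrow> 'a \<Rightarrow> nat \<Rightarrow> real) \<Rightarrow> (real \<Rightarrow> 'a \<Rightarrow> real) \<Rightarrow> bool" where
  "elementary_integral P F d S H Y \<longleftrightarrow>
     (\<exists>(m::nat) a b \<xi>0 \<xi>.
        (\<forall>i<m. 0 \<le> a i \<and> a i \<le> b i) \<and>
        (\<forall>j<d. bounded_rv P (F 0) (\<lambda>\<omega>. \<xi>0 \<omega> j)) \<and>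
        (\<forall>i<m. \<forall>j<d. bounded_rv P (F (a i)) (\<lambda>\<omega>. \<xi> i \<omega> j)) \<and>
        (\<forall>r\<ge>0. \<forall>\<omega>\<in>space P. \<forall>j<d.
           H r \<omega> j = indicator {0} r * \<xi>0 \<omega> j
                      + (\<Sum>i<m. indicator {a i<..b i} r * \<xi> i \<omega> j)) \<and>
        (\<forall>r\<ge>0. \<forall>\<omega>\<in>space P.
           Y r \<omega> = (\<Sum>i<m. \<Sum>j<d. \<xi> i \<omega> j * (S (min r (b i)) \<omega> j - S (min r (a i)) \<omega> j))))"

text \<open>Emery's semimartingale topology on real-valued processes is given by the quasi-norms
  \<open>E[1 \<and> |Z 0|] + sup {E[1 \<and> |(K \<bullet> Z) t|] | K elementary predictable, |K| \<le> 1}\<close>, \<open>t \<ge> 0\<close>.\<close>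

definition emery_size ::
  "'a measure \<Rightarrow> (real \<Rightarrow> 'a measure) \<Rightarrow> (real \<Rightarrow> 'a \<Rightarrow> real) \<Rightarrow> real \<Rightarrow> real" where
  "emery_size P F Z t =
     (\<integral>\<omega>. min 1 \<bar>Z 0 \<omega>\<bar> \<partial>P) +
     Sup {(\<integral>\<omega>. min 1 \<bar>Y t \<omega>\<bar> \<partial>P) | K Y.
            elementary_integral P F 1 (\<lambda>r \<omega> _. Z r \<omega>) K Y \<and>
            (\<forall>r\<ge>0. \<forall>\<omega>\<in>space P. \<bar>K r \<omega> 0\<bar> \<le> 1)}"

definition emery_tendsto ::
  "'a measure \<Rightarrow> (real \<Rightarrow> 'a measure) \<Rightarrow> (nat \<Rightarrow> real \<Rightarrow> 'a \<Rightarrow> real) \<Rightarrow> (real \<Rightarrow> 'a \<Rightarrow> real) \<Rightarrow> bool"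
  where
  "emery_tendsto P F Yk Y \<longleftrightarrow>
     (\<forall>t\<ge>0. (\<lambda>k. emery_size P F (\<lambda>r \<omega>. Yk k r \<omega> - Y r \<omega>) t) \<longlonglongrightarrow> 0)"

text \<open>
  \<open>stoch_integral P F d S H Y\<close>: the integrand \<open>H\<close> is integrable with respect to the
  \<open>\<real>\<^sup>d\<close>-valued semimartingale \<open>S\<close>, and \<open>Y\<close> is (a version of) the vector stochastic integral
  \<open>H \<bullet> S\<close>. The integral is the closure of the elementary integral under pointwise convergence of
  integrands together with convergence of the integrals in the semimartingale topology.

  For semimartingales \<open>S\<close> this is the usual vector stochastic integral of Jacod and Memin, in
  which \<open>H\<close> is integrable iff the integrals of the bounded integrands \<open>H 1\<^bsub>{|H| \<le> k}\<^esub>\<close> converge in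
  the semimartingale topology, \<open>H \<bullet> S\<close> being the limit. Indeed, elementary integrands generate all
  bounded predictable ones by the monotone class theorem and dominated convergence for stochastic
  integrals, and truncation then yields every integrable \<open>H\<close>. Conversely, let \<open>H\<^sub>k \<bullet> S \<rightarrow> Y\<close> and
  \<open>H\<^sub>k \<rightarrow> H\<close> pointwise. By Memin's closedness theorem \<open>Y = G \<bullet> S\<close> for some \<open>G\<close>. The sets
  \<open>B\<^sub>m = {sup\<^sub>k |H\<^sub>k - G| \<le> m}\<close> are predictable and increase to the whole space, and dominated
  convergence on \<open>B\<^sub>m\<close> gives \<open>(1\<^bsub>B\<^sub>m\<^esub> (H - G)) \<bullet> S = 0\<close>; hence \<open>H\<close> is integrable and
  \<open>H \<bullet> S = Y\<close>. The constant sequence in the second rule shows that \<open>Y\<close> may be replaced by any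
  indistinguishable adapted process.
\<close>

inductive stoch_integral ::
  "'a measure \<Rightarrow> (real \<Rightarrow> 'a measure) \<Rightarrow> nat \<Rightarrow> (real \<Rightarrow> 'a \<Rightarrow> nat \<Rightarrow> real) \<Rightarrow>
   (real \<Rightarrow> 'a \<Rightarrow> nat \<Rightarrow> real) \<Rightarrow> (real \<Rightarrow> 'a \<Rightarrow> real) \<Rightarrow> bool"
  for P F d S where
  elementary: "elementary_integral P F d S H Y \<Longrightarrow> stoch_integral P F d S H Y"
| limit: "\<lbrakk>\<And>k. stoch_integral P F d S (Hk k) (Yk k);
     \<forall>r\<ge>0. \<forall>\<omega>\<in>space P. \<forall>j<d. (\<lambda>k. Hk k r \<omega> j) \<longlonglongrightarrow> H r \<omega> j;
     adapted_cadlag P F Y;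
     emery_tendsto P F Yk Y\<rbrakk>
   \<Longrightarrow> stoch_integral P F d S H Y"


section \<open>The market\<close>

text \<open>\<open>admissible_integral P F d S H Y\<close>: \<open>H\<close> is predictable, \<open>S\<close>-integrable and admissible, and
  \<open>Y = H \<bullet> S\<close>.\<close>

definition admissible_integral ::
  "'a measure \<Rightarrow> (real \<Rightarrow> 'a measure) \<Rightarrow> nat \<Rightarrow> (real \<Rightarrow> 'a \<Rightarrow> nat \<Rightarrow> real) \<Rightarrow>
   (real \<Rightarrow> 'a \<Rightarrow> nat \<Rightarrow> real) \<Rightarrow> (real \<Rightarrow> 'a \<Rightarrow> real) \<Rightarrow> bool" where
  "admissible_integral P F d S H Y \<longleftrightarrow>
     predictable P F d H \<and> stoch_integral P F d S H Y \<and>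
     (\<exists>a>0. AE \<omega> in P. \<forall>t\<ge>0. - a \<le> Y t \<omega>)"

definition K_set ::
  "'a measure \<Rightarrow> (real \<Rightarrow> 'a measure) \<Rightarrow> nat \<Rightarrow> (real \<Rightarrow> 'a \<Rightarrow> nat \<Rightarrow> real) \<Rightarrow> ('a \<Rightarrow> real) set" where
  "K_set P F d S =
     {f \<in> borel_measurable P. \<exists>H Y. admissible_integral P F d S H Y \<and>
        (AE \<omega> in P. ((\<lambda>t. Y t \<omega>) \<longlongrightarrow> f \<omega>) at_top)}"

definition L0_plus :: "'a measure \<Rightarrow> ('a \<Rightarrow> real) set" where
  "L0_plus P = {h \<in> borel_measurable P. AE \<omega> in P. 0 \<le> h \<omega>}"

definition L_infty :: "'a measure \<Rightarrow> ('a \<Rightarrow> real) set" where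
  "L_infty P = {f \<in> borel_measurable P. \<exists>c. AE \<omega> in P. \<bar>f \<omega>\<bar> \<le> c}"

definition C_set ::
  "'a measure \<Rightarrow> (real \<Rightarrow> 'a measure) \<Rightarrow> nat \<Rightarrow> (real \<Rightarrow> 'a \<Rightarrow> nat \<Rightarrow> real) \<Rightarrow> ('a \<Rightarrow> real) set" where
  "C_set P F d S =
     {f \<in> L_infty P. \<exists>k\<in>K_set P F d S. \<exists>h\<in>L0_plus P. AE \<omega> in P. f \<omega> = k \<omega> - h \<omega>}"

definition equivalent_probs :: "'a measure \<Rightarrow> 'a measure set" where
  "equivalent_probs P =
     {Q. prob_space Q \<and> sets Q = sets P \<and> absolutely_continuous P Q \<and> absolutely_continuous Q P}"

definition M_set ::
  "'a measure \<Rightarrow> (real \<Rightarrow> 'a measure) \<Rightarrow> nat \<Rightarrow> (real \<Rightarrow> 'a \<Rightarrow> nat \<Rightarrow> real) \<Rightarrow> 'a measure set" where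
  "M_set P F d S =
     {Q. prob_space Q \<and> sets Q = sets P \<and> absolutely_continuous P Q \<and>
         (\<forall>f\<in>K_set P F d S. integrable Q f \<and> (\<integral>\<omega>. f \<omega> \<partial>Q) \<le> 0)}"

definition D_set :: "real \<Rightarrow> 'a measure \<Rightarrow> ('a \<Rightarrow> real) set" where
  "D_set \<epsilon> P =
     {w \<in> L_infty P. (AE \<omega> in P. 0 \<le> w \<omega> \<and> w \<omega> \<le> 1) \<and> \<epsilon> \<le> (\<integral>\<omega>. w \<omega> \<partial>P)}"

definition U2 :: "(real \<Rightarrow> real) set" where
  "U2 = {u. mono u \<and> concave_on UNIV u}"

definition market_model ::
  "'a measure \<Rightarrow> (real \<Rightarrow> 'a measure) \<Rightarrow> nat \<Rightarrow> (real \<Rightarrow> 'a \<Rightarrow> nat \<Rightarrow> real) \<Rightarrow> bool" where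
  "market_model P F d S \<longleftrightarrow>
     filtered_prob_space P F \<and> usual_conditions P F \<and> semimartingale_vec P F d S"


section \<open>Contiguity\<close>

text \<open>\<open>contiguous R P\<close> is \<open>(R\<^sup>n) \<lhd> (P\<^sup>n)\<close>.\<close>

definition contiguous :: "(nat \<Rightarrow> 'a measure) \<Rightarrow> (nat \<Rightarrow> 'a measure) \<Rightarrow> bool" where
  "contiguous R P \<longleftrightarrow>
     (\<forall>A. (\<forall>n. A n \<in> sets (P n)) \<longrightarrow> (\<lambda>n. measure (P n) (A n)) \<longlonglongrightarrow> 0 \<longrightarrow>
          (\<lambda>n. measure (R n) (A n)) \<longlonglongrightarrow> 0)"

definition mutually_contiguous :: "(nat \<Rightarrow> 'a measure) \<Rightarrow> (nat \<Rightarrow> 'a measure) \<Rightarrow> bool" where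
  "mutually_contiguous R P \<longleftrightarrow> contiguous R P \<and> contiguous P R"


section \<open>No asymptotic market free lunch\<close>

text \<open>The supremum over \<open>C_set\<close> and the limes superior are taken in the extended reals; the
  expectations themselves are finite since \<open>f - w\<close> is essentially bounded and a finite concave
  \<open>u\<close> is continuous.\<close>

definition NAMFL_star ::
  "(real \<Rightarrow> real) set \<Rightarrow> (nat \<Rightarrow> 'a measure) \<Rightarrow> (nat \<Rightarrow> real \<Rightarrow> 'a measure) \<Rightarrow> (nat \<Rightarrow> nat) \<Rightarrow>
   (nat \<Rightarrow> real \<Rightarrow> 'a \<Rightarrow> nat \<Rightarrow> real) \<Rightarrow> bool" where
  "NAMFL_star U P F d S \<longleftrightarrow>
     (\<forall>\<epsilon>>0. \<exists>\<delta>>0. \<exists>u\<in>U. \<exists>R.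
        (\<forall>n. R n \<in> equivalent_probs (P n)) \<and> mutually_contiguous R P \<and>
        (\<forall>w. (\<forall>n. w n \<in> D_set \<epsilon> (P n)) \<longrightarrow>
           limsup (\<lambda>n. SUP f\<in>C_set (P n) (F n) (d n) (S n).
                          ereal (\<integral>\<omega>. u (f \<omega> - w n \<omega>) \<partial>R n))
             < ereal (u 0 - \<delta>)))"

end

theory Submission
  imports Defs
begin

text \<open>
  If martingale measures \<open>Q\<^sup>n\<close> with \<open>(Q\<^sup>n) \<lhd>\<rhd> (P\<^sup>n)\<close> exist, take \<open>R\<^sup>n = Q\<^sup>n\<close> and \<open>u x = x\<close>: elements of
  \<open>C\<^sup>n\<close> have nonpositive \<open>Q\<^sup>n\<close>-expectation, and by contiguity \<open>w \<in> D\<close> implies that \<open>E\<^bsub>Q\<^esub>[w]\<close> is bounded away from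
  \<open>0\<close>. Conversely, the utility bound at level \<open>\<epsilon>\<close> says that the convex functional
  \<open>y \<mapsto> E\<^bsub>R\<^esub>[(u 0 - u (- y))\<^sup>+]\<close> is at least \<open>\<delta>\<close> on \<open>D - C\<close>. A Hahn--Banach argument in \<open>L\<^sup>\<infinity>\<close> yields a
  positive functional that is nonpositive on the cone \<open>C\<close>, at least \<open>\<delta>\<close> on \<open>D\<close>, and dominated by that convex
  functional up to a constant. The domination makes it countably additive, with a modulus of absolute continuity with
  respect to \<open>R\<close> that depends on \<open>u\<close> and \<open>\<delta>\<close> only; no weak-star closedness of \<open>C\<close> is needed. The resulting
  separating measures are contiguous to \<open>P\<close> and charge all events of \<open>P\<close>-probability at least \<open>\<epsilon>\<close> uniformly;
  mixing those for \<open>\<epsilon> = 1 / (k + 1)\<close> with geometric weights gives the required sequence.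
\<close>

section \<open>Linearity of the stochastic integral\<close>

text \<open>The obstacle is that Hahn--Banach in bounded functions yields a functional
  \<open>L\<close> that is only finitely additive. The separation is therefore kept as one
  inequality in three variables, \<open>L (y - w + f) \<le> E_R[loss u y] - \<delta>\<close> for
  bounded \<open>y\<close>, \<open>w\<close> in D and \<open>f\<close> in C, and every estimate is a
  choice of test elements. With \<open>w = 1\<close> and \<open>f = 0\<close>, the choice
  \<open>y = t * indicator A\<close> controls \<open>t * L (indicator A)\<close> by
  \<open>L 1\<close> and \<open>R A\<close>, and \<open>y = 2\<close> bounds \<open>L 1\<close>
  itself. After normalisation this reads
  \<open>Q A \<le> (loss u 2 + loss u t * R A) / (\<delta> * t)\<close>. Fixing a large
  \<open>t\<close> and then letting \<open>R A\<close> tend to 0 serves twice: along sets decreasing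
  to the empty set it gives countable additivity in one market, and along the sequence of markets it
  gives contiguity. Stochastic integration enters through C being a convex cone, so the linear
  structure has to be carried through the inductive closure that defines the integral. The
  separating measures are absolutely continuous but possibly not equivalent, and their bounds hold
  from some market on; the given equivalent martingale measures fill both gaps.\<close>

lemma cadlag_add: "cadlag x \<Longrightarrow> cadlag y \<Longrightarrow> cadlag (\<lambda>t. x t + y t)"
  unfolding cadlag_def by (blast intro: continuous_add tendsto_add)

lemma cadlag_cmult: "cadlag x \<Longrightarrow> cadlag (\<lambda>t. c * x t)" for c :: real
  unfolding cadlag_def by (blast intro: continuous_mult_left tendsto_mult_left)

lemma cadlag_const: "cadlag (\<lambda>t. c)"
  unfolding cadlag_def by auto

lemma cadlag_sum: "(\<And>i. i \<in> I \<Longrightarrow> cadlag (x i)) \<Longrightarrow> cadlag (\<lambda>t. \<Sum>i\<in>I. x i t)"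
  by (induction I rule: infinite_finite_induct) (auto intro: cadlag_add cadlag_const)

text \<open>Integrals are determined at nonnegative times only, so the path property must ignore
  values at negative times.\<close>

lemma cadlag_cong:
  assumes "\<And>t. 0 \<le> t \<Longrightarrow> x t = y t" and "cadlag y"
  shows "cadlag x"
  unfolding cadlag_def
proof (intro conjI allI impI)
  fix t :: real assume t: "0 \<le> t"
  have "(y \<longlongrightarrow> y t) (at_right t)"
    using assms(2) t by (auto simp: cadlag_def continuous_within)
  moreover have "eventually (\<lambda>s. y s = x s) (at_right t)"
    using assms(1) t by (auto simp: eventually_at_filter)
  ultimately show "continuous (at_right t) x"
    using assms(1)[OF t] by (auto simp: continuous_within dest: Lim_transform_eventually)
next
  fix t :: real assume t: "0 < t"
  then obtain l where "(y \<longlongrightarrow> l) (at_left t)"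
    using assms(2) by (auto simp: cadlag_def)
  moreover have "eventually (\<lambda>s. s > 0) (at_left t)"
    using t by (rule eventually_at_leftI[rotated]) auto
  then have "eventually (\<lambda>s. y s = x s) (at_left t)"
    by eventually_elim (simp add: assms(1))
  ultimately show "\<exists>l. (x \<longlongrightarrow> l) (at_left t)"
    by (blast dest: Lim_transform_eventually)
qed

lemma cadlag_stop:
  assumes "cadlag x"
  shows "cadlag (\<lambda>t. x (min t b))"
  unfolding cadlag_def
proof (intro conjI allI impI)
  fix t :: real assume t: "0 \<le> t"
  show "continuous (at_right t) (\<lambda>t. x (min t b))"
  proof (cases "t < b")
    case True
    have "(x \<longlongrightarrow> x t) (at_right t)"
      using assms t by (auto simp: cadlag_def continuous_within)
    moreover have "eventually (\<lambda>s. x s = x (min s b)) (at_right t)"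
      using True by (intro eventually_at_rightI[of _ b]) auto
    ultimately show ?thesis
      using True by (auto simp: continuous_within dest: Lim_transform_eventually)
  next
    case False
    have "eventually (\<lambda>s. x b = x (min s b)) (at_right t)"
      using False by (intro eventually_at_rightI[of _ "t + 1"]) auto
    then show ?thesis
      using False by (auto simp: continuous_within min_absorb2 intro: Lim_transform_eventually[OF tendsto_const])
  qed
next
  fix t :: real assume t: "0 < t"
  show "\<exists>l. ((\<lambda>t. x (min t b)) \<longlongrightarrow> l) (at_left t)"
  proof (cases "t \<le> b")
    case True
    obtain l where "(x \<longlongrightarrow> l) (at_left t)"
      using assms t by (auto simp: cadlag_def)
    moreover have "eventually (\<lambda>s. x s = x (min s b)) (at_left t)"
      using True by (intro eventually_at_leftI[of "t - 1"]) auto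
    ultimately have "((\<lambda>t. x (min t b)) \<longlongrightarrow> l) (at_left t)"
      by (rule Lim_transform_eventually)
    then show ?thesis ..
  next
    case False
    have "eventually (\<lambda>s. x b = x (min s b)) (at_left t)"
      using False by (intro eventually_at_leftI[of b]) auto
    then have "((\<lambda>t. x (min t b)) \<longlongrightarrow> x b) (at_left t)"
      by (rule Lim_transform_eventually[OF tendsto_const])
    then show ?thesis ..
  qed
qed

lemma adapted_cadlag_add:
  assumes X: "adapted_cadlag P F X" and Y: "adapted_cadlag P F Y"
  shows "adapted_cadlag P F (\<lambda>t \<omega>. X t \<omega> + Y t \<omega>)"
proof -
  have "AE \<omega> in P. cadlag (\<lambda>t. X t \<omega>)" "AE \<omega> in P. cadlag (\<lambda>t. Y t \<omega>)"
    using X Y by (auto simp: adapted_cadlag_def)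
  then have "AE \<omega> in P. cadlag (\<lambda>t. X t \<omega> + Y t \<omega>)"
    by eventually_elim (rule cadlag_add)
  then show ?thesis
    using X Y by (auto simp: adapted_cadlag_def adapted_def intro: borel_measurable_add)
qed

lemma adapted_cadlag_cmult:
  assumes X: "adapted_cadlag P F X"
  shows "adapted_cadlag P F (\<lambda>t \<omega>. c * X t \<omega>)"
proof -
  have "AE \<omega> in P. cadlag (\<lambda>t. X t \<omega>)"
    using X by (auto simp: adapted_cadlag_def)
  then have "AE \<omega> in P. cadlag (\<lambda>t. c * X t \<omega>)"
    by eventually_elim (rule cadlag_cmult)
  then show ?thesis
    using X by (auto simp: adapted_cadlag_def adapted_def intro: borel_measurable_times)
qed

section \<open>Elementary integrals: linearity, adaptedness, path regularity\<close>

lemma sum_lessThan_append: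
  fixes h :: "nat \<Rightarrow> real"
  assumes "\<And>i. i < m \<Longrightarrow> h i = f i" and "\<And>i. i < n \<Longrightarrow> h (m + i) = g i"
  shows "(\<Sum>i<m + n. h i) = (\<Sum>i<m. f i) + (\<Sum>i<n. g i)"
  using assms(2) by (induction n) (simp_all add: assms(1))

lemma elementary_integralE:
  assumes "elementary_integral P F d S H Y"
  obtains (rep) m :: nat and a b \<xi>0 \<xi> where
    "\<And>i. i < m \<Longrightarrow> 0 \<le> a i \<and> a i \<le> b i"
    "\<And>j. j < d \<Longrightarrow> bounded_rv P (F 0) (\<lambda>\<omega>. \<xi>0 \<omega> j)"
    "\<And>i j. i < m \<Longrightarrow> j < d \<Longrightarrow> bounded_rv P (F (a i)) (\<lambda>\<omega>. \<xi> i \<omega> j)"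
    "\<And>r \<omega> j. 0 \<le> r \<Longrightarrow> \<omega> \<in> space P \<Longrightarrow> j < d \<Longrightarrow>
        H r \<omega> j = indicator {0} r * \<xi>0 \<omega> j + (\<Sum>i<m. indicator {a i<..b i} r * \<xi> i \<omega> j)"
    "\<And>r \<omega>. 0 \<le> r \<Longrightarrow> \<omega> \<in> space P \<Longrightarrow>
        Y r \<omega> = (\<Sum>i<m. \<Sum>j<d. \<xi> i \<omega> j * (S (min r (b i)) \<omega> j - S (min r (a i)) \<omega> j))"
proof -
  obtain m :: nat and a b \<xi>0 \<xi> where
    *: "\<forall>i<m. 0 \<le> a i \<and> a i \<le> b i"
      "\<forall>j<d. bounded_rv P (F 0) (\<lambda>\<omega>. \<xi>0 \<omega> j)"
      "\<forall>i<m. \<forall>j<d. bounded_rv P (F (a i)) (\<lambda>\<omega>. \<xi> i \<omega> j)"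
      "\<forall>r\<ge>0. \<forall>\<omega>\<in>space P. \<forall>j<d.
         H r \<omega> j = indicator {0} r * \<xi>0 \<omega> j + (\<Sum>i<m. indicator {a i<..b i} r * \<xi> i \<omega> j)"
      "\<forall>r\<ge>0. \<forall>\<omega>\<in>space P.
         Y r \<omega> = (\<Sum>i<m. \<Sum>j<d. \<xi> i \<omega> j * (S (min r (b i)) \<omega> j - S (min r (a i)) \<omega> j))"
    using assms unfolding elementary_integral_def by blast
  show thesis
    by (rule rep[of m a b \<xi>0 \<xi>])
       ((rule *[rule_format]; assumption)+)
qed

text \<open>The intervals of a representation may overlap, so the two families are simply listed one
  after the other; no common refinement has to be formed.\<close>

lemma elementary_integral_add:
  assumes "elementary_integral P F d S H Y" and "elementary_integral P F d S H' Y'"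
  shows "elementary_integral P F d S (\<lambda>r \<omega> j. H r \<omega> j + H' r \<omega> j) (\<lambda>r \<omega>. Y r \<omega> + Y' r \<omega>)"
  using assms(1)
proof (cases rule: elementary_integralE)
  case 1: (rep m a b \<xi>0 \<xi>)
  from assms(2) show ?thesis
  proof (cases rule: elementary_integralE)
    case 2: (rep m' a' b' \<xi>0' \<xi>')
    define A where "A = (\<lambda>i. if i < m then a i else a' (i - m))"
    define B where "B = (\<lambda>i. if i < m then b i else b' (i - m))"
    define \<Xi> where "\<Xi> = (\<lambda>i. if i < m then \<xi> i else \<xi>' (i - m))"
    have bd0: "bounded_rv P (F 0) (\<lambda>\<omega>. \<xi>0 \<omega> j + \<xi>0' \<omega> j)" if j: "j < d" for j
    proof -
      obtain c c' where "\<forall>\<omega>\<in>space P. \<bar>\<xi>0 \<omega> j\<bar> \<le> c" "\<forall>\<omega>\<in>space P. \<bar>\<xi>0' \<omega> j\<bar> \<le> c'"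
        using 1(2)[OF j] 2(2)[OF j] unfolding bounded_rv_def by blast
      then have "\<forall>\<omega>\<in>space P. \<bar>\<xi>0 \<omega> j + \<xi>0' \<omega> j\<bar> \<le> c + c'"
        by (meson abs_triangle_ineq add_mono order_trans)
      then show ?thesis
        using 1(2)[OF j] 2(2)[OF j] unfolding bounded_rv_def by (auto intro!: borel_measurable_add)
  qed
    have c1: "0 \<le> A i \<and> A i \<le> B i" if "i < m + m'" for i
      using 1(1) 2(1)[of "i - m"] that unfolding A_def B_def by auto
    have c2: "bounded_rv P (F (A i)) (\<lambda>\<omega>. \<Xi> i \<omega> j)" if "i < m + m'" "j < d" for i j
      using 1(3)[of i j] 2(3)[of "i - m" j] that unfolding A_def \<Xi>_def by auto
    have c3: "H r \<omega> j + H' r \<omega> j = indicator {0} r * (\<xi>0 \<omega> j + \<xi>0' \<omega> j)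
        + (\<Sum>i<m + m'. indicator {A i<..B i} r * \<Xi> i \<omega> j)"
      if "0 \<le> r" "\<omega> \<in> space P" "j < d" for r \<omega> j
    proof -
      have "(\<Sum>i<m + m'. indicator {A i<..B i} r * \<Xi> i \<omega> j) =
         (\<Sum>i<m. indicator {a i<..b i} r * \<xi> i \<omega> j) + (\<Sum>i<m'. indicator {a' i<..b' i} r * \<xi>' i \<omega> j)"
        by (rule sum_lessThan_append) (simp_all add: A_def B_def \<Xi>_def)
      then show ?thesis
        using 1(4)[OF that] 2(4)[OF that] by (simp add: algebra_simps)
  qed
    have c4: "Y r \<omega> + Y' r \<omega> =
        (\<Sum>i<m + m'. \<Sum>j<d. \<Xi> i \<omega> j * (S (min r (B i)) \<omega> j - S (min r (A i)) \<omega> j))"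
      if "0 \<le> r" "\<omega> \<in> space P" for r \<omega>
      unfolding 1(5)[OF that] 2(5)[OF that]
      by (rule sum_lessThan_append[symmetric]) (simp_all add: A_def B_def \<Xi>_def)
    show ?thesis
      unfolding elementary_integral_def
      by (rule exI[of _ "m + m'"], rule exI[of _ A], rule exI[of _ B],
          rule exI[of _ "\<lambda>\<omega> j. \<xi>0 \<omega> j + \<xi>0' \<omega> j"], rule exI[of _ \<Xi>])
         (intro conjI allI impI ballI; (rule c2 c3 c4 bd0 c1[THEN conjunct1] c1[THEN conjunct2]; assumption))
  qed
qed

lemma elementary_integral_cmult:
  assumes "elementary_integral P F d S H Y"
  shows "elementary_integral P F d S (\<lambda>r \<omega> j. c * H r \<omega> j) (\<lambda>r \<omega>. c * Y r \<omega>)"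
  using assms
proof (cases rule: elementary_integralE)
  case 1: (rep m a b \<xi>0 \<xi>)
  have bd: "bounded_rv P G (\<lambda>\<omega>. c * \<zeta> \<omega>)" if \<zeta>: "bounded_rv P G \<zeta>" for G \<zeta>
  proof -
    obtain k where "\<forall>\<omega>\<in>space P. \<bar>\<zeta> \<omega>\<bar> \<le> k"
      using \<zeta> unfolding bounded_rv_def by blast
    then have "\<forall>\<omega>\<in>space P. \<bar>c * \<zeta> \<omega>\<bar> \<le> \<bar>c\<bar> * k"
      by (simp add: abs_mult mult_left_mono)
    then show ?thesis
      using \<zeta> unfolding bounded_rv_def by (auto intro!: borel_measurable_times)
  qed
  have c3: "c * H r \<omega> j = indicator {0} r * (c * \<xi>0 \<omega> j)
      + (\<Sum>i<m. indicator {a i<..b i} r * (c * \<xi> i \<omega> j))"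
    if "0 \<le> r" "\<omega> \<in> space P" "j < d" for r \<omega> j
    by (simp only: 1(4)[OF that] distrib_left sum_distrib_left mult.left_commute[of c])
  have c4: "c * Y r \<omega> =
      (\<Sum>i<m. \<Sum>j<d. c * \<xi> i \<omega> j * (S (min r (b i)) \<omega> j - S (min r (a i)) \<omega> j))"
    if "0 \<le> r" "\<omega> \<in> space P" for r \<omega>
    using 1(5)[OF that] by (simp add: sum_distrib_left mult.assoc)
  show ?thesis
    unfolding elementary_integral_def
    by (rule exI[of _ m], rule exI[of _ a], rule exI[of _ b],
        rule exI[of _ "\<lambda>\<omega> j. c * \<xi>0 \<omega> j"], rule exI[of _ "\<lambda>i \<omega> j. c * \<xi> i \<omega> j"])
       (intro conjI allI impI ballI;
        (rule c3 c4 bd[OF 1(2)] bd[OF 1(3)] 1(1)[THEN conjunct1] 1(1)[THEN conjunct2]; assumption))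
qed

lemma elementary_integral_zero: "elementary_integral P F d S (\<lambda>r \<omega> j. 0) (\<lambda>r \<omega>. 0)"
  unfolding elementary_integral_def
  by (rule exI[of _ 0], rule exI[of _ "\<lambda>_. 0"], rule exI[of _ "\<lambda>_. 0"], rule exI[of _ "\<lambda>_ _. 0"],
      rule exI[of _ "\<lambda>_ _ _. 0"]) (auto simp: bounded_rv_def)

lemma filtered_prob_space_subalgebra:
  assumes "filtered_prob_space P F" and "0 \<le> s" and "s \<le> t"
  shows "subalgebra (F t) (F s)"
  using assms unfolding filtered_prob_space_def subalgebra_def by (metis order_trans)

lemma elementary_integral_adapted:
  assumes F: "filtered_prob_space P F"
    and S: "\<And>j. j < d \<Longrightarrow> adapted F (\<lambda>t \<omega>. S t \<omega> j)"
    and E: "elementary_integral P F d S H Y"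
  shows "adapted F Y"
  using E
proof (cases rule: elementary_integralE)
  case 1: (rep m a b \<xi>0 \<xi>)
  have "Y r \<in> borel_measurable (F r)" if r: "0 \<le> r" for r
  proof -
    have meas: "(\<lambda>\<omega>. \<xi> i \<omega> j * (S (min r (b i)) \<omega> j - S (min r (a i)) \<omega> j)) \<in> borel_measurable (F r)"
      if i: "i < m" and j: "j < d" for i j
    \<comment> \<open>Up to time \<open>a i\<close> the increment is 0, although \<xi> need not yet
      be measurable there; afterwards \<xi> is measurable because the filtration increases.\<close>
    proof (cases "r \<le> a i")
      case True
      then have "min r (b i) = r" "min r (a i) = r"
        using 1(1)[OF i] by auto
      then show ?thesis by simp
    next
      case False
      have "(\<lambda>\<omega>. \<xi> i \<omega> j) \<in> borel_measurable (F r)"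
        using 1(3)[OF i j] 1(1)[OF i] False filtered_prob_space_subalgebra[OF F, of "a i" r]
        by (auto simp: bounded_rv_def intro: measurable_from_subalg)
      moreover have "(\<lambda>\<omega>. S s \<omega> j) \<in> borel_measurable (F r)" if "0 \<le> s" "s \<le> r" for s
        using S[OF j] that filtered_prob_space_subalgebra[OF F that]
        by (auto simp: adapted_def intro: measurable_from_subalg)
      ultimately show ?thesis
        using r 1(1)[OF i] by (auto intro!: borel_measurable_times borel_measurable_diff)
    qed
    have "space (F r) = space P"
      using F r by (auto simp: filtered_prob_space_def subalgebra_def)
    then have "Y r \<in> borel_measurable (F r) \<longleftrightarrow>
        (\<lambda>\<omega>. \<Sum>i<m. \<Sum>j<d. \<xi> i \<omega> j * (S (min r (b i)) \<omega> j - S (min r (a i)) \<omega> j)) \<in> borel_measurable (F r)"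
      using 1(5) r by (intro measurable_cong) auto
    then show ?thesis
      using meas by (auto intro!: borel_measurable_sum)
  qed
  then show ?thesis
    unfolding adapted_def by blast
qed

lemma elementary_integral_adapted_cadlag:
  assumes F: "filtered_prob_space P F"
    and S: "\<And>j. j < d \<Longrightarrow> adapted_cadlag P F (\<lambda>t \<omega>. S t \<omega> j)"
    and E: "elementary_integral P F d S H Y"
  shows "adapted_cadlag P F Y"
  unfolding adapted_cadlag_def
proof (rule conjI)
  show "adapted F Y"
    using elementary_integral_adapted[OF F _ E] S by (auto simp: adapted_cadlag_def)
  from E show "AE \<omega> in P. cadlag (\<lambda>t. Y t \<omega>)"
  proof (cases rule: elementary_integralE)
    case 1: (rep m a b \<xi>0 \<xi>)
    have "AE \<omega> in P. \<forall>j\<in>{..<d}. cadlag (\<lambda>t. S t \<omega> j)"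
      using S by (intro AE_finite_allI) (auto simp: adapted_cadlag_def)
    then show ?thesis
      using AE_space
    proof eventually_elim
      case (elim \<omega>)
      have "cadlag (\<lambda>t. \<xi> i \<omega> j * (S (min t (b i)) \<omega> j + (-1) * S (min t (a i)) \<omega> j))" if "j < d" for i j
        using elim that by (intro cadlag_cmult cadlag_add cadlag_stop) auto
      then have "cadlag (\<lambda>r. \<Sum>i<m. \<Sum>j<d. \<xi> i \<omega> j * (S (min r (b i)) \<omega> j - S (min r (a i)) \<omega> j))"
        by (intro cadlag_sum) auto
      then show ?case
        using 1(5) elim by (intro cadlag_cong[where x = "\<lambda>t. Y t \<omega>"]) auto
    qed
  qed
qed

lemma stoch_integral_adapted_cadlag:
  assumes "filtered_prob_space P F"
    and "\<And>j. j < d \<Longrightarrow> adapted_cadlag P F (\<lambda>t \<omega>. S t \<omega> j)"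
    and "stoch_integral P F d S H Y"
  shows "adapted_cadlag P F Y"
  using assms(3) by cases (auto intro: elementary_integral_adapted_cadlag[OF assms(1,2)])

section \<open>The quasi-norms of the semimartingale topology\<close>

lemma (in prob_space) integral_min_1_abs:
  fixes X :: "'a \<Rightarrow> real"
  shows "0 \<le> (\<integral>\<omega>. min 1 \<bar>X \<omega>\<bar> \<partial>M)" "(\<integral>\<omega>. min 1 \<bar>X \<omega>\<bar> \<partial>M) \<le> 1"
proof -
  show "0 \<le> (\<integral>\<omega>. min 1 \<bar>X \<omega>\<bar> \<partial>M)"
    by simp
  show "(\<integral>\<omega>. min 1 \<bar>X \<omega>\<bar> \<partial>M) \<le> 1"
    \<comment> \<open>A nonintegrable function has integral 0 by convention, which makes the bound
      hold for arbitrary \<open>X\<close>.\<close>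
    by (cases "integrable M (\<lambda>\<omega>. min 1 \<bar>X \<omega>\<bar>)")
       (auto simp: not_integrable_integral_eq intro!: integral_le_const)
qed

text \<open>The zero integrand contributes the value 0 and the truncation at 1 bounds all values, so
  \<open>Sup\<close> is taken over a nonempty bounded set and is at least 0.\<close>

lemma emery_size_nonneg:
  assumes "prob_space P"
  shows "0 \<le> emery_size P F Z t"
proof -
  interpret prob_space P by fact
  let ?U = "{(\<integral>\<omega>. min 1 \<bar>Y t \<omega>\<bar> \<partial>P) | K Y. elementary_integral P F 1 (\<lambda>r \<omega> _. Z r \<omega>) K Y \<and>
            (\<forall>r\<ge>0. \<forall>\<omega>\<in>space P. \<bar>K r \<omega> (0::nat)\<bar> \<le> 1)}"
  have "(\<integral>\<omega>. min 1 \<bar>0::real\<bar> \<partial>P) \<in> ?U"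
    using elementary_integral_zero[of P F 1 "\<lambda>r \<omega> _. Z r \<omega>"] by force
  moreover have "bdd_above ?U"
    using integral_min_1_abs by (intro bdd_aboveI[of _ 1]) auto
  ultimately have "(\<integral>\<omega>. min 1 \<bar>0::real\<bar> \<partial>P) \<le> Sup ?U"
    by (rule cSup_upper)
  then show ?thesis
    unfolding emery_size_def using integral_min_1_abs(1)[of "Z 0"] by simp
qed

text \<open>The truncation at 1 destroys homogeneity. The pointwise inequality \<open>min 1 \<bar>c
  * x\<bar> \<le> max 1 \<bar>c\<bar> * min 1 \<bar>x\<bar>\<close> replaces it and is enough to
  carry convergence to 0 over to multiples.\<close>

lemma emery_size_cmult_le:
  assumes F: "filtered_prob_space P F" and Z: "adapted F Z" and t: "0 \<le> t"
  shows "emery_size P F (\<lambda>r \<omega>. c * Z r \<omega>) t \<le> max 1 \<bar>c\<bar> * emery_size P F Z t"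
proof -
  interpret prob_space P using F by (simp add: filtered_prob_space_def)
  define U where "U = (\<lambda>Z. {(\<integral>\<omega>. min 1 \<bar>Y t \<omega>\<bar> \<partial>P) | K Y.
      elementary_integral P F 1 (\<lambda>r \<omega> _. Z r \<omega>) K Y \<and> (\<forall>r\<ge>0. \<forall>\<omega>\<in>space P. \<bar>K r \<omega> (0::nat)\<bar> \<le> 1)})"
  have bdd: "bdd_above (U Z)" for Z :: "real \<Rightarrow> 'a \<Rightarrow> real"
    unfolding U_def using integral_min_1_abs by (intro bdd_aboveI[of _ 1]) auto
  have ne: "U Z \<noteq> {}" for Z :: "real \<Rightarrow> 'a \<Rightarrow> real"
    unfolding U_def using elementary_integral_zero[of P F 1 "\<lambda>r \<omega> _. Z r \<omega>"] by force
  have sub: "subalgebra P (F s)" if "0 \<le> s" for s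
    using F that by (auto simp: filtered_prob_space_def)
  have le: "(\<integral>\<omega>. min 1 \<bar>c * X \<omega>\<bar> \<partial>P) \<le> max 1 \<bar>c\<bar> * (\<integral>\<omega>. min 1 \<bar>X \<omega>\<bar> \<partial>P)"
    if [measurable]: "X \<in> borel_measurable P" for X
  proof -
    have int: "integrable P (\<lambda>\<omega>. min 1 \<bar>Y \<omega>\<bar>)" if "Y \<in> borel_measurable P" for Y :: "'a \<Rightarrow> real"
      using that by (intro integrable_const_bound[of _ 1]) auto
    have "min 1 \<bar>c * X \<omega>\<bar> \<le> max 1 \<bar>c\<bar> * min 1 \<bar>X \<omega>\<bar>" for \<omega>
    proof (cases "\<bar>X \<omega>\<bar> \<le> 1")
      case True
      have "\<bar>c * X \<omega>\<bar> \<le> max 1 \<bar>c\<bar> * \<bar>X \<omega>\<bar>"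
        by (auto simp: abs_mult intro!: mult_right_mono)
      then show ?thesis using True by (auto simp: min_def)
    qed auto
    then have "(\<integral>\<omega>. min 1 \<bar>c * X \<omega>\<bar> \<partial>P) \<le> (\<integral>\<omega>. max 1 \<bar>c\<bar> * min 1 \<bar>X \<omega>\<bar> \<partial>P)"
      using int by (intro integral_mono) auto
    then show ?thesis by simp
  qed
  have "x \<le> max 1 \<bar>c\<bar> * Sup (U Z)" if x: "x \<in> U (\<lambda>r \<omega>. c * Z r \<omega>)" for x
  proof -
    obtain K Y where xe: "x = (\<integral>\<omega>. min 1 \<bar>Y t \<omega>\<bar> \<partial>P)"
      and E: "elementary_integral P F 1 (\<lambda>r \<omega> _. c * Z r \<omega>) K Y"
      and K: "\<forall>r\<ge>0. \<forall>\<omega>\<in>space P. \<bar>K r \<omega> (0::nat)\<bar> \<le> 1"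
      using x unfolding U_def by blast
    \<comment> \<open>The representation of \<open>K\<close> is integrated against \<open>Z\<close>
      directly; dividing \<open>Y\<close> by \<open>c\<close> would fail at
      \<open>c = 0\<close>.\<close>
    from E have "\<exists>Y'. elementary_integral P F 1 (\<lambda>r \<omega> _. Z r \<omega>) K Y' \<and>
        (\<forall>\<omega>\<in>space P. Y t \<omega> = c * Y' t \<omega>)"
    proof (cases rule: elementary_integralE)
      case 1: (rep m a b \<xi>0 \<xi>)
      define Y' where "Y' = (\<lambda>r \<omega>. \<Sum>i<m. \<Sum>j<1::nat. \<xi> i \<omega> j * (Z (min r (b i)) \<omega> - Z (min r (a i)) \<omega>))"
      have "elementary_integral P F 1 (\<lambda>r \<omega> _. Z r \<omega>) K Y'"
        unfolding elementary_integral_def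
        by (rule exI[of _ m], rule exI[of _ a], rule exI[of _ b], rule exI[of _ \<xi>0], rule exI[of _ \<xi>])
           (intro conjI allI impI ballI;
            (rule 1(2) 1(3) 1(4) 1(1)[THEN conjunct1] 1(1)[THEN conjunct2] Y'_def[THEN fun_cong, THEN fun_cong]; assumption?))
      moreover have "Y t \<omega> = c * Y' t \<omega>" if "\<omega> \<in> space P" for \<omega>
        using 1(5)[OF t that]
        by (simp only: Y'_def sum_distrib_left right_diff_distrib[symmetric] mult.left_commute[of c])
      ultimately show ?thesis by blast
    qed
    then obtain Y' where E': "elementary_integral P F 1 (\<lambda>r \<omega> _. Z r \<omega>) K Y'"
      and Y: "\<And>\<omega>. \<omega> \<in> space P \<Longrightarrow> Y t \<omega> = c * Y' t \<omega>"
      by blast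
    have "Y' t \<in> borel_measurable P"
      using elementary_integral_adapted[OF F _ E'] Z t sub[OF t]
      by (auto simp: adapted_def intro: measurable_from_subalg)
    from le[OF this] have "x \<le> max 1 \<bar>c\<bar> * (\<integral>\<omega>. min 1 \<bar>Y' t \<omega>\<bar> \<partial>P)"
      unfolding xe by (simp add: Y cong: Bochner_Integration.integral_cong)
    also have "\<dots> \<le> max 1 \<bar>c\<bar> * Sup (U Z)"
      using E' K by (intro mult_left_mono cSup_upper bdd) (auto simp: U_def)
    finally show ?thesis .
  qed
  then have "Sup (U (\<lambda>r \<omega>. c * Z r \<omega>)) \<le> max 1 \<bar>c\<bar> * Sup (U Z)"
    using ne by (intro cSup_least) auto
  moreover have "Z 0 \<in> borel_measurable P"
    using Z sub[of 0] by (auto simp: adapted_def intro: measurable_from_subalg)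
  then have "(\<integral>\<omega>. min 1 \<bar>c * Z 0 \<omega>\<bar> \<partial>P) \<le> max 1 \<bar>c\<bar> * (\<integral>\<omega>. min 1 \<bar>Z 0 \<omega>\<bar> \<partial>P)"
    by (rule le)
  ultimately show ?thesis
    unfolding emery_size_def U_def by (simp add: distrib_left)
qed

section \<open>Linearity in the inductive closure, and the cone of terminal gains\<close>

context
  fixes P :: "'a measure" and F :: "real \<Rightarrow> 'a measure" and d :: nat
    and S :: "real \<Rightarrow> 'a \<Rightarrow> nat \<Rightarrow> real"
  assumes F: "filtered_prob_space P F"
    and S: "\<And>j. j < d \<Longrightarrow> adapted_cadlag P F (\<lambda>t \<omega>. S t \<omega> j)"
begin

text \<open>Additivity is proved by induction on one summand while the other is held fixed: first a
  fixed elementary summand, then, with this as the base case, a fixed general one. The fixed process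
  cancels in the distance between approximants and limit.\<close>

lemma stoch_integral_add_elementary:
  assumes "stoch_integral P F d S H Y" and E: "elementary_integral P F d S H' Y'"
  shows "stoch_integral P F d S (\<lambda>r \<omega> j. H r \<omega> j + H' r \<omega> j) (\<lambda>r \<omega>. Y r \<omega> + Y' r \<omega>)"
  using assms(1)
proof induction
  case (elementary H Y)
  then show ?case
    using E by (intro stoch_integral.elementary elementary_integral_add)
next
  case (limit Hk Yk H Y)
  show ?case
  proof (rule stoch_integral.limit[OF limit.IH])
    show "adapted_cadlag P F (\<lambda>r \<omega>. Y r \<omega> + Y' r \<omega>)"
      using limit elementary_integral_adapted_cadlag[OF F S E] by (intro adapted_cadlag_add) auto
    show "emery_tendsto P F (\<lambda>k r \<omega>. Yk k r \<omega> + Y' r \<omega>) (\<lambda>r \<omega>. Y r \<omega> + Y' r \<omega>)"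
      using limit.hyps(4) by (simp add: emery_tendsto_def)
    show "\<forall>r\<ge>0. \<forall>\<omega>\<in>space P. \<forall>j<d. (\<lambda>k. Hk k r \<omega> j + H' r \<omega> j) \<longlonglongrightarrow> H r \<omega> j + H' r \<omega> j"
      using limit.hyps(2) by (simp add: tendsto_add)
  qed
qed

lemma stoch_integral_add:
  assumes "stoch_integral P F d S H Y" and I: "stoch_integral P F d S H' Y'"
  shows "stoch_integral P F d S (\<lambda>r \<omega> j. H r \<omega> j + H' r \<omega> j) (\<lambda>r \<omega>. Y r \<omega> + Y' r \<omega>)"
  using assms(1)
proof induction
  case (elementary H Y)
  then show ?case
    using stoch_integral_add_elementary[OF I, of H Y] by (simp add: add.commute)
next
  case (limit Hk Yk H Y)
  show ?case
  proof (rule stoch_integral.limit[OF limit.IH])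
    show "adapted_cadlag P F (\<lambda>r \<omega>. Y r \<omega> + Y' r \<omega>)"
      using limit stoch_integral_adapted_cadlag[OF F S I] by (intro adapted_cadlag_add) auto
    show "emery_tendsto P F (\<lambda>k r \<omega>. Yk k r \<omega> + Y' r \<omega>) (\<lambda>r \<omega>. Y r \<omega> + Y' r \<omega>)"
      using limit.hyps(4) by (simp add: emery_tendsto_def)
    show "\<forall>r\<ge>0. \<forall>\<omega>\<in>space P. \<forall>j<d. (\<lambda>k. Hk k r \<omega> j + H' r \<omega> j) \<longlonglongrightarrow> H r \<omega> j + H' r \<omega> j"
      using limit.hyps(2) by (simp add: tendsto_add)
  qed
qed

lemma stoch_integral_cmult:
  assumes "stoch_integral P F d S H Y"
  shows "stoch_integral P F d S (\<lambda>r \<omega> j. c * H r \<omega> j) (\<lambda>r \<omega>. c * Y r \<omega>)"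
  using assms
proof induction
  case (elementary H Y)
  then show ?case
    by (intro stoch_integral.elementary elementary_integral_cmult)
next
  case (limit Hk Yk H Y)
  have P: "prob_space P" using F by (simp add: filtered_prob_space_def)
  show ?case
  proof (rule stoch_integral.limit[OF limit.IH])
    show "adapted_cadlag P F (\<lambda>r \<omega>. c * Y r \<omega>)"
      using limit by (intro adapted_cadlag_cmult) auto
    have ad: "adapted F (\<lambda>r \<omega>. Yk k r \<omega> - Y r \<omega>)" for k
      using stoch_integral_adapted_cadlag[OF F S limit.hyps(1)[of k]] limit.hyps(3)
      by (auto simp: adapted_cadlag_def adapted_def intro: borel_measurable_diff)
    show "emery_tendsto P F (\<lambda>k r \<omega>. c * Yk k r \<omega>) (\<lambda>r \<omega>. c * Y r \<omega>)"
      unfolding emery_tendsto_def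
    proof (intro allI impI)
      fix t :: real assume t: "0 \<le> t"
      have "(\<lambda>k. max 1 \<bar>c\<bar> * emery_size P F (\<lambda>r \<omega>. Yk k r \<omega> - Y r \<omega>) t) \<longlonglongrightarrow> max 1 \<bar>c\<bar> * 0"
        using limit.hyps(4) t unfolding emery_tendsto_def by (intro tendsto_mult_left) auto
      then have lim: "(\<lambda>k. max 1 \<bar>c\<bar> * emery_size P F (\<lambda>r \<omega>. Yk k r \<omega> - Y r \<omega>) t) \<longlonglongrightarrow> 0"
        by (simp only: mult_zero_right)
      have "(\<lambda>k. emery_size P F (\<lambda>r \<omega>. c * (Yk k r \<omega> - Y r \<omega>)) t) \<longlonglongrightarrow> 0"
        by (rule tendsto_sandwich[OF always_eventually always_eventually tendsto_const lim])
           (intro allI emery_size_nonneg P emery_size_cmult_le F ad t)+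
      then show "(\<lambda>k. emery_size P F (\<lambda>r \<omega>. c * Yk k r \<omega> - c * Y r \<omega>) t) \<longlonglongrightarrow> 0"
        by (simp only: right_diff_distrib)
    qed
    show "\<forall>r\<ge>0. \<forall>\<omega>\<in>space P. \<forall>j<d. (\<lambda>k. c * Hk k r \<omega> j) \<longlonglongrightarrow> c * H r \<omega> j"
      using limit.hyps(2) by (simp add: tendsto_mult_left)
  qed
qed

lemma admissible_integral_add:
  assumes "admissible_integral P F d S H Y" and "admissible_integral P F d S H' Y'"
  shows "admissible_integral P F d S (\<lambda>r \<omega> j. H r \<omega> j + H' r \<omega> j) (\<lambda>r \<omega>. Y r \<omega> + Y' r \<omega>)"
proof -
  obtain a a' where a: "a > 0" "AE \<omega> in P. \<forall>t\<ge>0. - a \<le> Y t \<omega>"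
    and a': "a' > 0" "AE \<omega> in P. \<forall>t\<ge>0. - a' \<le> Y' t \<omega>"
    using assms unfolding admissible_integral_def by blast
  have "AE \<omega> in P. \<forall>t\<ge>0. - (a + a') \<le> Y t \<omega> + Y' t \<omega>"
    using a(2) a'(2) by eventually_elim (smt (verit))
  moreover have "predictable P F d (\<lambda>r \<omega> j. H r \<omega> j + H' r \<omega> j)"
    using assms unfolding admissible_integral_def predictable_def
    by (auto simp: case_prod_beta' intro!: borel_measurable_add)
  ultimately show ?thesis
    using assms a(1) a'(1) stoch_integral_add unfolding admissible_integral_def
    by (meson add_pos_pos)
qed

lemma admissible_integral_cmult:
  assumes "admissible_integral P F d S H Y" and "c > 0"
  shows "admissible_integral P F d S (\<lambda>r \<omega> j. c * H r \<omega> j) (\<lambda>r \<omega>. c * Y r \<omega>)"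
proof -
  obtain a where a: "a > 0" "AE \<omega> in P. \<forall>t\<ge>0. - a \<le> Y t \<omega>"
    using assms unfolding admissible_integral_def by blast
  have "AE \<omega> in P. \<forall>t\<ge>0. - (c * a) \<le> c * Y t \<omega>"
    using a(2)
  proof eventually_elim
    case (elim \<omega>)
    then show ?case
      using mult_left_mono[of "- a" "Y _ \<omega>" c] assms(2) by auto
  qed
  moreover have "predictable P F d (\<lambda>r \<omega> j. c * H r \<omega> j)"
    using assms unfolding admissible_integral_def predictable_def
    by (auto simp: case_prod_beta' intro!: borel_measurable_times)
  ultimately show ?thesis
    using assms a(1) stoch_integral_cmult unfolding admissible_integral_def
    by (meson mult_pos_pos)
qed

lemma K_set_add:
  assumes "f \<in> K_set P F d S" and "g \<in> K_set P F d S"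
  shows "(\<lambda>\<omega>. f \<omega> + g \<omega>) \<in> K_set P F d S"
proof -
  obtain H Y H' Y' where I: "admissible_integral P F d S H Y" "admissible_integral P F d S H' Y'"
    and "AE \<omega> in P. ((\<lambda>t. Y t \<omega>) \<longlongrightarrow> f \<omega>) at_top" "AE \<omega> in P. ((\<lambda>t. Y' t \<omega>) \<longlongrightarrow> g \<omega>) at_top"
    using assms unfolding K_set_def by blast
  from this(3,4) have "AE \<omega> in P. ((\<lambda>t. Y t \<omega> + Y' t \<omega>) \<longlongrightarrow> f \<omega> + g \<omega>) at_top"
    by eventually_elim (rule tendsto_add)
  then show ?thesis
    using admissible_integral_add[OF I] assms unfolding K_set_def
    by (auto intro!: borel_measurable_add exI)
qed

lemma K_set_cmult:
  assumes "f \<in> K_set P F d S" and "c > 0"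
  shows "(\<lambda>\<omega>. c * f \<omega>) \<in> K_set P F d S"
proof -
  obtain H Y where I: "admissible_integral P F d S H Y"
    and "AE \<omega> in P. ((\<lambda>t. Y t \<omega>) \<longlongrightarrow> f \<omega>) at_top"
    using assms unfolding K_set_def by blast
  from this(2) have "AE \<omega> in P. ((\<lambda>t. c * Y t \<omega>) \<longlongrightarrow> c * f \<omega>) at_top"
    by eventually_elim (rule tendsto_mult_left)
  then show ?thesis
    using admissible_integral_cmult[OF I assms(2)] assms unfolding K_set_def
    by (auto intro!: borel_measurable_times exI)
qed

end

lemma zero_in_K_set: "(\<lambda>\<omega>. 0) \<in> K_set P F d S"
proof -
  have "admissible_integral P F d S (\<lambda>r \<omega> j. 0) (\<lambda>r \<omega>. 0)"
    unfolding admissible_integral_def predictable_def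
    using stoch_integral.elementary[OF elementary_integral_zero] by (auto intro: exI[of _ 1])
  then show ?thesis unfolding K_set_def by auto
qed

lemma K_set_bounded_below:
  assumes "f \<in> K_set P F d S"
  shows "\<exists>a\<ge>0. AE \<omega> in P. - a \<le> f \<omega>"
proof -
  obtain Y :: "real \<Rightarrow> 'a \<Rightarrow> real" and a where a: "a > 0" "AE \<omega> in P. \<forall>t\<ge>0. - a \<le> Y t \<omega>"
    and Y: "AE \<omega> in P. ((\<lambda>t. Y t \<omega>) \<longlongrightarrow> f \<omega>) at_top"
    using assms unfolding K_set_def admissible_integral_def by blast
  have "AE \<omega> in P. - a \<le> f \<omega>"
    using a(2) Y
  proof eventually_elim
    case (elim \<omega>)
    have "eventually (\<lambda>t. - a \<le> Y t \<omega>) at_top"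
      using eventually_ge_at_top[of 0] by eventually_elim (use elim(1) in blast)
    then show ?case
      by (rule tendsto_lowerbound[OF elim(2)]) simp
  qed
  then show ?thesis using a(1) by (auto intro: exI[of _ a])
qed

section \<open>A Hahn--Banach separation on spaces of functions\<close>

text \<open>Functions are compared pointwise, with no passage to almost sure classes; that
  functionals respect almost sure equality is recovered from positivity in
  \<open>positive_functional_measure\<close>.\<close>

definition fun_subspace :: "('a \<Rightarrow> real) set \<Rightarrow> bool" where
  "fun_subspace V \<longleftrightarrow> (\<lambda>x. 0) \<in> V \<and> (\<forall>f\<in>V. \<forall>g\<in>V. (\<lambda>x. f x + g x) \<in> V) \<and>
     (\<forall>f\<in>V. \<forall>c. (\<lambda>x. c * f x) \<in> V)"

definition fun_linear :: "('a \<Rightarrow> real) set \<Rightarrow> (('a \<Rightarrow> real) \<Rightarrow> real) \<Rightarrow> bool" where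
  "fun_linear V L \<longleftrightarrow> (\<forall>f\<in>V. \<forall>g\<in>V. L (\<lambda>x. f x + g x) = L f + L g) \<and>
     (\<forall>f\<in>V. \<forall>c. L (\<lambda>x. c * f x) = c * L f)"

definition fun_sublinear :: "('a \<Rightarrow> real) set \<Rightarrow> (('a \<Rightarrow> real) \<Rightarrow> real) \<Rightarrow> bool" where
  "fun_sublinear V p \<longleftrightarrow> (\<forall>f\<in>V. \<forall>g\<in>V. p (\<lambda>x. f x + g x) \<le> p f + p g) \<and>
     (\<forall>f\<in>V. \<forall>c>0. p (\<lambda>x. c * f x) = c * p f)"

lemma fun_subspaceD:
  assumes "fun_subspace V"
  shows "(\<lambda>x. 0) \<in> V" and "f \<in> V \<Longrightarrow> g \<in> V \<Longrightarrow> (\<lambda>x. f x + g x) \<in> V"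
    and "f \<in> V \<Longrightarrow> (\<lambda>x. c * f x) \<in> V" and "f \<in> V \<Longrightarrow> (\<lambda>x. - f x) \<in> V"
    and "f \<in> V \<Longrightarrow> g \<in> V \<Longrightarrow> (\<lambda>x. f x - g x) \<in> V"
proof -
  show 0: "(\<lambda>x. 0) \<in> V" and 1: "f \<in> V \<Longrightarrow> g \<in> V \<Longrightarrow> (\<lambda>x. f x + g x) \<in> V"
    and 2: "f \<in> V \<Longrightarrow> (\<lambda>x. c * f x) \<in> V" for f g c
    using assms unfolding fun_subspace_def by blast+
  show 3: "f \<in> V \<Longrightarrow> (\<lambda>x. - f x) \<in> V" for f
    using 2[of f "-1"] by simp
  show "f \<in> V \<Longrightarrow> g \<in> V \<Longrightarrow> (\<lambda>x. f x - g x) \<in> V" for f g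
    using 1[of f "\<lambda>x. - g x"] 3[of g] by simp
qed

section \<open>Sublinear functionals and Zorn's lemma\<close>

lemma fun_sublinearD:
  assumes "fun_sublinear V p"
  shows "f \<in> V \<Longrightarrow> g \<in> V \<Longrightarrow> p (\<lambda>x. f x + g x) \<le> p f + p g"
    and "f \<in> V \<Longrightarrow> c > 0 \<Longrightarrow> p (\<lambda>x. c * f x) = c * p f"
  using assms unfolding fun_sublinear_def by blast+

lemma fun_sublinear_zero:
  assumes "fun_subspace V" and "fun_sublinear V p"
  shows "p (\<lambda>x. 0) = 0"
  using fun_sublinearD(2)[OF assms(2) fun_subspaceD(1)[OF assms(1)], of 2] by simp

lemma fun_sublinear_minus:
  assumes V: "fun_subspace V" and p: "fun_sublinear V p" and f: "f \<in> V"
  shows "- p (\<lambda>x. - f x) \<le> p f"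
  using fun_sublinearD(1)[OF p f fun_subspaceD(4)[OF V f]] fun_sublinear_zero[OF V p] by simp

lemma fun_sublinear_odd_imp_linear:
  assumes V: "fun_subspace V" and p: "fun_sublinear V p"
    and odd: "\<And>f. f \<in> V \<Longrightarrow> p (\<lambda>x. - f x) \<le> - p f"
  shows "fun_linear V p"
proof -
  have minus: "p (\<lambda>x. - f x) = - p f" if "f \<in> V" for f
    using odd[OF that] fun_sublinear_minus[OF V p that] by simp
  have "p (\<lambda>x. f x + g x) = p f + p g" if f: "f \<in> V" and g: "g \<in> V" for f g
  proof (rule antisym)
    show "p (\<lambda>x. f x + g x) \<le> p f + p g"
      by (rule fun_sublinearD(1)[OF p f g])
    have "p (\<lambda>x. - f x + - g x) \<le> p (\<lambda>x. - f x) + p (\<lambda>x. - g x)"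
      by (rule fun_sublinearD(1)[OF p fun_subspaceD(4)[OF V f] fun_subspaceD(4)[OF V g]])
    then show "p f + p g \<le> p (\<lambda>x. f x + g x)"
      using minus[OF f] minus[OF g] minus[OF fun_subspaceD(2)[OF V f g]] by simp
  qed
  moreover have "p (\<lambda>x. c * f x) = c * p f" if f: "f \<in> V" for f c
  proof -
    consider "c > 0" | "c = 0" | "- c > 0" by linarith
    then show ?thesis
    proof cases
      case 3
      have "p (\<lambda>x. - c * f x) = - c * p f"
        by (rule fun_sublinearD(2)[OF p f 3])
      then show ?thesis
        using minus[OF fun_subspaceD(3)[OF V f, of c]] by simp
    qed (use fun_sublinearD(2)[OF p f] fun_sublinear_zero[OF V p] in auto)
  qed
  ultimately show ?thesis unfolding fun_linear_def by blast
qed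

text \<open>A minimal sublinear functional is linear: it may be lowered in the direction of any vector
  \<open>v\<close> to \<open>\<lambda>x. inf\<^bsub>t\<ge>0\<^esub> p (x + t v) - t p v\<close>.\<close>

lemma minimal_sublinear_odd:
  assumes V: "fun_subspace V" and p: "fun_sublinear V p"
    and min: "\<And>q f. fun_sublinear V q \<Longrightarrow> (\<And>g. g \<in> V \<Longrightarrow> q g \<le> p g) \<Longrightarrow> f \<in> V \<Longrightarrow> q f = p f"
    and v: "v \<in> V"
  shows "p (\<lambda>x. - v x) \<le> - p v"
proof -
  define A where "A = (\<lambda>f. {p (\<lambda>x. f x + t * v x) - t * p v | t. t \<ge> 0})"
  define q where "q = (\<lambda>f. Inf (A f))"
  note VD = fun_subspaceD[OF V] and pD = fun_sublinearD[OF p]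
  have bdd: "bdd_below (A f)" if f: "f \<in> V" for f
  proof (rule bdd_belowI[of _ "- p (\<lambda>x. - f x)"])
    fix a assume "a \<in> A f"
    then obtain t where t: "t \<ge> 0" "a = p (\<lambda>x. f x + t * v x) - t * p v"
      unfolding A_def by blast
    have "t * p v = p (\<lambda>x. t * v x)"
      using pD(2)[OF v] fun_sublinear_zero[OF V p] t(1) by (cases "t = 0") auto
    also have "\<dots> = p (\<lambda>x. (f x + t * v x) + - f x)" by simp
    also have "\<dots> \<le> p (\<lambda>x. f x + t * v x) + p (\<lambda>x. - f x)"
      using f v by (intro pD(1) VD)
    finally show "- p (\<lambda>x. - f x) \<le> a" using t(2) by simp
  qed
  have le: "q f \<le> p (\<lambda>x. f x + t * v x) - t * p v" if "f \<in> V" "t \<ge> 0" for f t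
    unfolding q_def using that by (intro cInf_lower bdd) (auto simp: A_def)
  have ge: "b \<le> q f" if "\<And>t. t \<ge> 0 \<Longrightarrow> b \<le> p (\<lambda>x. f x + t * v x) - t * p v" for b f
    unfolding q_def using that by (intro cInf_greatest) (auto simp: A_def intro: exI[of _ 0])
  have "fun_sublinear V q"
    unfolding fun_sublinear_def
  proof (intro conjI ballI allI impI)
    fix f g assume f: "f \<in> V" and g: "g \<in> V"
    have "q (\<lambda>x. f x + g x) - (p (\<lambda>x. g x + s * v x) - s * p v) \<le> p (\<lambda>x. f x + t * v x) - t * p v"
      if "t \<ge> 0" "s \<ge> 0" for t s
    proof -
      have "q (\<lambda>x. f x + g x) \<le> p (\<lambda>x. f x + g x + (t + s) * v x) - (t + s) * p v"
        using that f g by (intro le VD) auto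
      also have "p (\<lambda>x. f x + g x + (t + s) * v x) = p (\<lambda>x. (f x + t * v x) + (g x + s * v x))"
        by (simp add: algebra_simps)
      also have "\<dots> \<le> p (\<lambda>x. f x + t * v x) + p (\<lambda>x. g x + s * v x)"
        using f g v by (intro pD(1) VD)
      finally show ?thesis by (simp add: algebra_simps)
    qed
    then have "q (\<lambda>x. f x + g x) - (p (\<lambda>x. g x + s * v x) - s * p v) \<le> q f" if "s \<ge> 0" for s
      using that by (intro ge)
    then have "q (\<lambda>x. f x + g x) - q f \<le> q g"
      by (intro ge) (simp add: algebra_simps)
    then show "q (\<lambda>x. f x + g x) \<le> q f + q g" by simp
  next
    fix f and c :: real assume f: "f \<in> V" and c: "c > 0"
    have 1: "q (\<lambda>x. c * f x) \<le> c * q f" if f: "f \<in> V" and c: "c > 0" for f c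
    proof -
      have "q (\<lambda>x. c * f x) / c \<le> q f"
      proof (rule ge)
        fix t :: real assume t: "t \<ge> 0"
        have "q (\<lambda>x. c * f x) \<le> p (\<lambda>x. c * f x + c * t * v x) - c * t * p v"
          using t c f by (intro le VD) auto
        also have "p (\<lambda>x. c * f x + c * t * v x) = p (\<lambda>x. c * (f x + t * v x))"
          by (simp add: algebra_simps)
        also have "\<dots> = c * p (\<lambda>x. f x + t * v x)"
          using f v c by (intro pD(2) VD)
        finally show "q (\<lambda>x. c * f x) / c \<le> p (\<lambda>x. f x + t * v x) - t * p v"
          using c by (simp add: field_simps)
      qed
      then show ?thesis using c by (simp add: field_simps)
    qed
    have "q (\<lambda>x. (1 / c) * (c * f x)) \<le> (1 / c) * q (\<lambda>x. c * f x)"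
      using f c by (intro 1 VD) auto
    then show "q (\<lambda>x. c * f x) = c * q f"
      using 1[OF f c] c by (simp add: field_simps)
  qed
  moreover have "q f \<le> p f" if "f \<in> V" for f
    using le[OF that, of 0] by simp
  ultimately have "q (\<lambda>x. - v x) = p (\<lambda>x. - v x)"
    using VD(4)[OF v] by (intro min)
  \<comment> \<open>The value \<open>t = 1\<close> in the infimum at \<open>- v\<close> gives
    \<open>p 0 - p v\<close>, and minimality identifies that infimum with
    \<open>p (- v)\<close>.\<close>
  then show ?thesis
    using le[OF VD(4)[OF v], of 1] fun_sublinear_zero[OF V p] by simp
qed

text \<open>Zorn's lemma produces a minimal sublinear functional below \<open>p\<close>, and
  minimality makes it linear. No functional is extended from a smaller subspace.\<close>

lemma sublinear_dominates_linear:
  assumes V: "fun_subspace V" and p: "fun_sublinear V p"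
  shows "\<exists>L. fun_linear V L \<and> (\<forall>f\<in>V. L f \<le> p f)"
proof -
  \<comment> \<open>Values off \<open>V\<close> are normalised to 0, so that comparison on
    \<open>V\<close> amounts to comparison everywhere. The relation \<open>R\<close> below reverses
    the pointwise order, hence its maximal elements are the minimal functionals.\<close>
  define \<S> where "\<S> = {q. fun_sublinear V q \<and> (\<forall>f\<in>V. q f \<le> p f) \<and> (\<forall>f. f \<notin> V \<longrightarrow> q f = 0)}"
  define R where "R = (\<lambda>q r :: ('a \<Rightarrow> real) \<Rightarrow> real. \<forall>f. r f \<le> q f)"
  note VD = fun_subspaceD[OF V]
  have po: "partial_order_on \<S> (relation_of R \<S>)"
  proof (rule partial_order_on_relation_ofI)
    show "q = r" if "q \<in> \<S>" "r \<in> \<S>" "R q r" "R r q" for q r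
      using that(3,4) unfolding R_def by (intro ext antisym) auto
  qed (auto simp: R_def intro: order_trans)
  have "\<exists>u\<in>\<S>. \<forall>a\<in>C. R a u" if C: "C \<in> Chains (relation_of R \<S>)" for C
  proof (cases "C = {}")
    case True
    have "(\<lambda>f. if f \<in> V then p f else 0) \<in> \<S>"
      using p VD unfolding \<S>_def fun_sublinear_def by auto
    then show ?thesis using True by auto
  next
    case False
    have CS: "q \<in> \<S>" if "q \<in> C" for q
      using C that unfolding Chains_def relation_of_def by blast
    have tot: "R a b \<or> R b a" if "a \<in> C" "b \<in> C" for a b
      using C that unfolding Chains_def relation_of_def by blast
    have sub: "fun_sublinear V q" "f \<in> V \<Longrightarrow> q f \<le> p f" "f \<notin> V \<Longrightarrow> q f = 0" if "q \<in> C" for q f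
      using CS[OF that] unfolding \<S>_def by auto
    define u where "u = (\<lambda>f. INF q\<in>C. q f)"
    have bdd: "bdd_below ((\<lambda>q. q f) ` C)" for f
    proof (rule bdd_belowI2)
      fix q assume q: "q \<in> C"
      \<comment> \<open>A sublinear \<open>q\<close> below \<open>p\<close> satisfies
        \<open>q f \<ge> - q (- f) \<ge> - p (- f)\<close>, a bound that is the same for the whole
        chain.\<close>
      show "(if f \<in> V then - p (\<lambda>x. - f x) else 0) \<le> q f"
      proof (cases "f \<in> V")
        case True
        then show ?thesis
          using fun_sublinear_minus[OF V sub(1)[OF q] True] sub(2)[OF q VD(4)[OF True]] by simp
      qed (use sub(3)[OF q] in simp)
    qed
    have lower: "u f \<le> q f" if "q \<in> C" for q f
      unfolding u_def by (rule cINF_lower[OF bdd that])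
    have greatest: "b \<le> u f" if "\<And>q. q \<in> C \<Longrightarrow> b \<le> q f" for b f
      unfolding u_def by (rule cINF_greatest[OF False that])
    have "fun_sublinear V u"
      unfolding fun_sublinear_def
    proof (intro conjI ballI allI impI)
      fix f g assume f: "f \<in> V" and g: "g \<in> V"
      have "u (\<lambda>x. f x + g x) - q f \<le> r g" if q: "q \<in> C" and r: "r \<in> C" for q r
      proof -
        \<comment> \<open>An infimum of sublinear functionals need not be subadditive; in a chain it
          is, because one member lies below both \<open>q\<close> and \<open>r\<close>.\<close>
        obtain s where s: "s \<in> C" "s f \<le> q f" "s g \<le> r g"
          using tot[OF q r] q r unfolding R_def by blast
        have "u (\<lambda>x. f x + g x) \<le> s f + s g"
          using lower[OF s(1)] fun_sublinearD(1)[OF sub(1)[OF s(1)] f g] order_trans by blast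
        then show ?thesis using s by simp
      qed
      then have "u (\<lambda>x. f x + g x) - q f \<le> u g" if "q \<in> C" for q
        using that by (intro greatest)
      then have "u (\<lambda>x. f x + g x) - u g \<le> u f"
        by (intro greatest) (simp add: algebra_simps)
      then show "u (\<lambda>x. f x + g x) \<le> u f + u g" by simp
    next
      fix f and c :: real assume f: "f \<in> V" and c: "c > 0"
      have hom: "q (\<lambda>x. c * f x) = c * q f" if "q \<in> C" for q
        by (rule fun_sublinearD(2)[OF sub(1)[OF that] f c])
      have "u (\<lambda>x. c * f x) / c \<le> u f"
      proof (rule greatest)
        fix q assume q: "q \<in> C"
        show "u (\<lambda>x. c * f x) / c \<le> q f"
          using lower[OF q, of "\<lambda>x. c * f x"] c unfolding hom[OF q] by (simp add: field_simps)
      qed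
      moreover have "c * u f \<le> u (\<lambda>x. c * f x)"
      proof (rule greatest)
        fix q assume q: "q \<in> C"
        show "c * u f \<le> q (\<lambda>x. c * f x)"
          unfolding hom[OF q] using lower[OF q, of f] c by simp
      qed
      ultimately show "u (\<lambda>x. c * f x) = c * u f"
        using c by (simp add: field_simps)
    qed
    moreover obtain q where q: "q \<in> C" using False by blast
    then have "\<forall>f\<in>V. u f \<le> p f"
      using lower[OF q] sub(2)[OF q] order_trans by blast
    moreover have "u f = 0" if "f \<notin> V" for f
    proof (rule antisym)
      show "u f \<le> 0" using lower[OF q, of f] sub(3)[OF q that] by simp
      show "0 \<le> u f" by (rule greatest) (simp add: sub(3)[OF _ that])
    qed
    ultimately have "u \<in> \<S>" unfolding \<S>_def by blast
    then show ?thesis using lower unfolding R_def by blast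
  qed
  from predicate_Zorn[OF po this]
  obtain m where m: "m \<in> \<S>" and max: "\<And>a. a \<in> \<S> \<Longrightarrow> R m a \<Longrightarrow> a = m"
    by blast
  have msub: "fun_sublinear V m" using m unfolding \<S>_def by blast
  have "q f = m f" if q: "fun_sublinear V q" and le: "\<And>g. g \<in> V \<Longrightarrow> q g \<le> m g" and f: "f \<in> V" for q f
  proof -
    define r where "r = (\<lambda>f. if f \<in> V then q f else 0)"
    have "fun_sublinear V r"
      using q VD unfolding r_def fun_sublinear_def by auto
    moreover have "r g \<le> p g" if "g \<in> V" for g
      using le[OF that] m that unfolding r_def \<S>_def by fastforce
    ultimately have "r \<in> \<S>" unfolding \<S>_def r_def by auto
    moreover have "R m r"
      using le m unfolding R_def r_def \<S>_def by auto
    ultimately have "r = m" by (rule max)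
    then show ?thesis using f unfolding r_def by (auto dest: fun_cong[of _ _ f])
  qed
  note min = this
  have "m (\<lambda>x. - v x) \<le> - m v" if "v \<in> V" for v
    by (rule minimal_sublinear_odd[OF V msub _ that]) (rule min)
  then have "fun_linear V m"
    by (rule fun_sublinear_odd_imp_linear[OF V msub])
  then show ?thesis using m unfolding \<S>_def by blast
qed

text \<open>\<open>E\<close> plays the role of the epigraph of a convex function \<open>h\<close> with \<open>h 0 \<ge> 0\<close> that is finite
  near the origin along every direction; the linear functional is found below the directional derivative
  \<open>\<lambda>z. inf\<^bsub>t>0\<^esub> h (t z) / t\<close>.\<close>

lemma convex_epigraph_linear_minorant:
  fixes E :: "(('a \<Rightarrow> real) \<times> real) set"
  assumes V: "fun_subspace V"
    and sub: "\<And>z a. (z, a) \<in> E \<Longrightarrow> z \<in> V"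
    and conv: "\<And>z a y b s t. (z, a) \<in> E \<Longrightarrow> (y, b) \<in> E \<Longrightarrow> 0 < s \<Longrightarrow> 0 < t \<Longrightarrow> s + t = 1 \<Longrightarrow>
       (\<lambda>x. s * z x + t * y x, s * a + t * b) \<in> E"
    and dir: "\<And>z. z \<in> V \<Longrightarrow> \<exists>t>0. \<exists>a. (\<lambda>x. t * z x, a) \<in> E"
    and zero: "\<And>a. (\<lambda>x. 0, a) \<in> E \<Longrightarrow> 0 \<le> a"
  shows "\<exists>L. fun_linear V L \<and> (\<forall>(z, a)\<in>E. L z \<le> a)"
proof -
  define A where "A = (\<lambda>z. {a / t | a t. t > 0 \<and> (\<lambda>x. t * z x, a) \<in> E})"
  define q where "q = (\<lambda>z. Inf (A z))"
  note VD = fun_subspaceD[OF V]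
  \<comment> \<open>Weights inversely matched to \<open>t\<close> and \<open>s\<close> give both
    directions the common length \<open>s * t / (s + t)\<close>. Dividing the combined height by
    this length yields \<open>a / t + b / s\<close>, the sum of the two slopes.\<close>
  have comb: "(\<lambda>x. (s * t / (s + t)) * (z x + y x), (s * a + t * b) / (s + t)) \<in> E"
    if "0 < s" "0 < t" "(\<lambda>x. t * z x, a) \<in> E" "(\<lambda>x. s * y x, b) \<in> E" for s t z y a b
  proof -
    have "(\<lambda>x. s / (s + t) * (t * z x) + t / (s + t) * (s * y x), s / (s + t) * a + t / (s + t) * b) \<in> E"
      using that by (intro conv) (auto simp: add_divide_distrib[symmetric])
    then show ?thesis
      by (simp add: algebra_simps add_divide_distrib)
  qed
  have bdd: "bdd_below (A z)" if z: "z \<in> V" for z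
  proof -
    obtain s b where s: "s > 0" "(\<lambda>x. s * - z x, b) \<in> E"
      using dir[OF VD(4)[OF z]] by blast
    have "- b / s \<le> a / t" if t: "t > 0" "(\<lambda>x. t * z x, a) \<in> E" for a t
    proof -
      \<comment> \<open>Points on the ray of \<open>z\<close> and on the opposite ray average to the
        origin, where heights in \<open>E\<close> are nonnegative. A single point on the opposite
        ray thus bounds all slopes along \<open>z\<close> from below.\<close>
      have "(\<lambda>x. (s * t / (s + t)) * (z x + - z x), (s * a + t * b) / (s + t)) \<in> E"
        using s t by (intro comb)
      then have "0 \<le> (s * a + t * b) / (s + t)" by (intro zero) simp
      then have "0 \<le> s * a + t * b" using s t by (simp add: zero_le_divide_iff)
      then show ?thesis using s t by (simp add: field_simps)
    qed
    then show ?thesis unfolding A_def by (intro bdd_belowI[of _ "- b / s"]) auto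
  qed
  have le: "q z \<le> a / t" if "z \<in> V" "t > 0" "(\<lambda>x. t * z x, a) \<in> E" for z a t
    unfolding q_def using that by (intro cInf_lower bdd) (auto simp: A_def)
  have ge: "b \<le> q z" if "z \<in> V" "\<And>a t. t > 0 \<Longrightarrow> (\<lambda>x. t * z x, a) \<in> E \<Longrightarrow> b \<le> a / t" for b z
    unfolding q_def
  proof (rule cInf_greatest)
    show "A z \<noteq> {}" using dir[OF that(1)] unfolding A_def by blast
  qed (use that(2) in \<open>auto simp: A_def\<close>)
  have "fun_sublinear V q"
    unfolding fun_sublinear_def
  proof (intro conjI ballI allI impI)
    fix f g assume f: "f \<in> V" and g: "g \<in> V"
    have "q (\<lambda>x. f x + g x) - b / s \<le> a / t"
      if t: "t > 0" "(\<lambda>x. t * f x, a) \<in> E" and s: "s > 0" "(\<lambda>x. s * g x, b) \<in> E" for a b s t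
    proof -
      have "q (\<lambda>x. f x + g x) \<le> ((s * a + t * b) / (s + t)) / (s * t / (s + t))"
        using s t f g by (intro le VD comb) auto
      also have "\<dots> = (s * a + t * b) / (s * t)"
        using s t by simp
      also have "\<dots> = a / t + b / s" using s t by (simp add: field_simps)
      finally show ?thesis by simp
    qed
    then have "q (\<lambda>x. f x + g x) - b / s \<le> q f" if "s > 0" "(\<lambda>x. s * g x, b) \<in> E" for b s
      using that f by (intro ge)
    then have "q (\<lambda>x. f x + g x) - q f \<le> q g"
      using g by (intro ge) (simp_all add: algebra_simps)
    then show "q (\<lambda>x. f x + g x) \<le> q f + q g" by simp
  next
    fix f and c :: real assume f: "f \<in> V" and c: "c > 0"
    have 1: "q (\<lambda>x. c * f x) \<le> c * q f" if f: "f \<in> V" and c: "c > 0" for f c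
    proof -
      have "q (\<lambda>x. c * f x) / c \<le> q f"
      proof (rule ge[OF f])
        fix a t assume t: "t > (0::real)" "(\<lambda>x. t * f x, a) \<in> E"
        have "q (\<lambda>x. c * f x) \<le> a / (t / c)"
          using t c f by (intro le VD) auto
        then show "q (\<lambda>x. c * f x) / c \<le> a / t" using c t by (simp add: field_simps)
      qed
      then show ?thesis using c by (simp add: field_simps)
    qed
    have "q (\<lambda>x. (1 / c) * (c * f x)) \<le> (1 / c) * q (\<lambda>x. c * f x)"
      using f c by (intro 1 VD) auto
    then show "q (\<lambda>x. c * f x) = c * q f"
      using 1[OF f c] c by (simp add: field_simps)
  qed
  then obtain L where L: "fun_linear V L" "\<forall>f\<in>V. L f \<le> q f"
    using sublinear_dominates_linear[OF V] by blast
  have "L z \<le> a" if "(z, a) \<in> E" for z a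
    using L(2) sub[OF that] le[OF sub[OF that], of 1 a] that by fastforce
  then show ?thesis using L(1) by blast
qed

section \<open>From a positive functional to a separating measure\<close>

lemma fun_linearD:
  assumes "fun_linear V L"
  shows "f \<in> V \<Longrightarrow> g \<in> V \<Longrightarrow> L (\<lambda>x. f x + g x) = L f + L g"
    and "f \<in> V \<Longrightarrow> L (\<lambda>x. c * f x) = c * L f"
  using assms unfolding fun_linear_def by blast+

lemma L_infty_bounded: "f \<in> borel_measurable P \<Longrightarrow> (\<And>x. x \<in> space P \<Longrightarrow> \<bar>f x\<bar> \<le> c) \<Longrightarrow> f \<in> L_infty P"
  unfolding L_infty_def by auto

lemma L_infty_indicator: "A \<in> sets P \<Longrightarrow> indicator A \<in> L_infty P"
  by (rule L_infty_bounded[of _ _ 1]) (auto simp: indicator_def)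

lemma L_infty_const: "(\<lambda>x. c) \<in> L_infty P"
  by (rule L_infty_bounded[of _ _ "\<bar>c\<bar>"]) auto

lemma fun_subspace_L_infty: "fun_subspace (L_infty P)"
  unfolding fun_subspace_def
proof (intro conjI ballI allI)
  show "(\<lambda>x. 0) \<in> L_infty P" by (rule L_infty_const)
next
  fix f g assume "f \<in> L_infty P" "g \<in> L_infty P"
  then obtain c d where [measurable]: "f \<in> borel_measurable P" "g \<in> borel_measurable P"
    and "AE x in P. \<bar>f x\<bar> \<le> c" "AE x in P. \<bar>g x\<bar> \<le> d"
    unfolding L_infty_def by blast
  from this(3,4) have "AE x in P. \<bar>f x + g x\<bar> \<le> c + d" by eventually_elim linarith
  then show "(\<lambda>x. f x + g x) \<in> L_infty P" unfolding L_infty_def by auto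
next
  fix f and k :: real assume "f \<in> L_infty P"
  then obtain c where [measurable]: "f \<in> borel_measurable P" and "AE x in P. \<bar>f x\<bar> \<le> c"
    unfolding L_infty_def by blast
  from this(2) have "AE x in P. \<bar>k * f x\<bar> \<le> \<bar>k\<bar> * c"
    by eventually_elim (simp add: abs_mult mult_left_mono)
  then show "(\<lambda>x. k * f x) \<in> L_infty P" unfolding L_infty_def by auto
qed

lemma L_infty_mono:
  assumes "g \<in> L_infty P" and "f \<in> borel_measurable P"
    and "\<And>x. x \<in> space P \<Longrightarrow> 0 \<le> f x" and "\<And>x. x \<in> space P \<Longrightarrow> f x \<le> g x"
  shows "f \<in> L_infty P"
proof -
  obtain c where "AE x in P. \<bar>g x\<bar> \<le> c" using assms(1) unfolding L_infty_def by blast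
  then have "AE x in P. \<bar>f x\<bar> \<le> c"
    using AE_space
  proof eventually_elim
    case (elim x)
    then show ?case using assms(3,4)[of x] by simp
  qed
  then show ?thesis using assms(2) unfolding L_infty_def by blast
qed

text \<open>Continuity along sets decreasing to the empty set upgrades finite to countable
  additivity, and positivity modulo \<open>P\<close>-null sets gives absolute continuity. For
  functions the inequality between integral and \<open>L\<close> is enough, and it passes to
  monotone limits by monotonicity of \<open>L\<close> alone.\<close>

lemma positive_functional_measure:
  fixes L :: "('a \<Rightarrow> real) \<Rightarrow> real"
  assumes P: "prob_space P" and L: "fun_linear (L_infty P) L"
    and pos: "\<And>f. f \<in> L_infty P \<Longrightarrow> AE x in P. 0 \<le> f x \<Longrightarrow> 0 \<le> L f"
    and one: "L (\<lambda>x. 1) = 1"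
    and cont: "\<And>A. range A \<subseteq> sets P \<Longrightarrow> decseq A \<Longrightarrow> (\<Inter>i. A i) = {} \<Longrightarrow>
      (\<lambda>i. L (indicator (A i))) \<longlonglongrightarrow> 0"
  shows "\<exists>Q. prob_space Q \<and> sets Q = sets P \<and> absolutely_continuous P Q \<and>
    (\<forall>A\<in>sets P. measure Q A = L (indicator A)) \<and>
    (\<forall>f\<in>L_infty P. (AE x in P. 0 \<le> f x) \<longrightarrow> (\<integral>\<^sup>+x. f x \<partial>Q) \<le> L f)"
proof -
  note VD = fun_subspaceD[OF fun_subspace_L_infty] and LD = fun_linearD[OF L]
  have mono: "L f \<le> L g" if f: "f \<in> L_infty P" and g: "g \<in> L_infty P" and "AE x in P. f x \<le> g x" for f g
  proof -
    have "0 \<le> L (\<lambda>x. g x + (-1) * f x)"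
      using that(3) VD(5)[OF g f] by (intro pos) auto
    also have "\<dots> = L g - L f"
      using LD(1)[OF g VD(3)[OF f, of "-1"]] LD(2)[OF f, of "-1"] by simp
    finally show ?thesis by simp
  qed
  have cong: "L f = L g" if "f \<in> L_infty P" "g \<in> L_infty P" "AE x in P. f x = g x" for f g
    using that by (intro antisym mono) (auto elim: eventually_mono)
  have zero: "L (\<lambda>x. 0) = 0" using LD(2)[OF VD(1), of 0] by simp
  define \<mu> where "\<mu> = (\<lambda>A. ennreal (L (indicator A)))"
  define Q where "Q = measure_of (space P) (sets P) \<mu>"
  have setsQ: "sets Q = sets P" and spaceQ: "space Q = space P"
    unfolding Q_def by (simp_all add: sets.sets_measure_of_eq space_measure_of_conv)
  have ind0: "0 \<le> L (indicator A)" if "A \<in> sets P" for A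
    using that by (intro pos L_infty_indicator) auto
  have "indicator {} = (\<lambda>x :: 'a. 0 :: real)" by auto
  then have positive: "positive (sets P) \<mu>"
    using zero by (simp add: positive_def \<mu>_def)
  have "countably_additive (sets P) \<mu>"
  proof (rule sets.empty_continuous_imp_countably_additive[OF positive])
    show "additive (sets P) \<mu>"
      unfolding additive_def
    proof (intro ballI impI)
      fix A B assume A: "A \<in> sets P" and B: "B \<in> sets P" and AB: "A \<inter> B = {}"
      have "indicator (A \<union> B) = (\<lambda>x. indicator A x + indicator B x :: real)"
        using AB by (auto simp: indicator_def fun_eq_iff)
      then have "L (indicator (A \<union> B)) = L (indicator A) + L (indicator B)"
        using LD(1)[OF L_infty_indicator[OF A] L_infty_indicator[OF B]] by simp
      then show "\<mu> (A \<union> B) = \<mu> A + \<mu> B"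
        using ind0 A B by (simp add: \<mu>_def ennreal_plus)
    qed
    show "\<forall>A\<in>sets P. \<mu> A \<noteq> \<infinity>" by (simp add: \<mu>_def)
    show "(\<lambda>i. \<mu> (A i)) \<longlonglongrightarrow> 0" if "range A \<subseteq> sets P" "decseq A" "(\<Inter>i. A i) = {}" for A
      using cont[OF that] unfolding \<mu>_def by (metis tendsto_ennrealI ennreal_0)
  qed
  then have em: "emeasure Q A = \<mu> A" if "A \<in> sets P" for A
    unfolding Q_def using positive that sets.sigma_algebra_axioms by (intro emeasure_measure_of_sigma)
  have meas: "measure Q A = L (indicator A)" if "A \<in> sets P" for A
    using em[OF that] ind0[OF that] by (simp add: measure_def \<mu>_def)
  have "L (indicator (space P)) = 1"
    using one cong[OF L_infty_indicator[of "space P" P] L_infty_const[of 1]] by auto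
  then have prob: "prob_space Q"
    using em[of "space P"] by (intro prob_spaceI) (simp add: spaceQ \<mu>_def)
  have ac: "absolutely_continuous P Q"
    unfolding absolutely_continuous_def
  proof
    fix N assume N: "N \<in> null_sets P"
    then have "AE x in P. indicator N x = (0::real)"
      by (auto intro!: eventually_mono[OF AE_not_in[OF N]] simp: indicator_def)
    then have "L (indicator N) = 0"
      using cong[OF L_infty_indicator VD(1)] zero N by auto
    then show "N \<in> null_sets Q"
      using em[of N] N by (auto simp: null_sets_def \<mu>_def setsQ)
  qed
  \<comment> \<open>Membership in \<open>L_infty\<close> is part of the induction predicate:
    nonnegative summands and approximants from below inherit it by domination from the function they
    build.\<close>
  have int: "u \<in> L_infty P \<longrightarrow> (\<integral>\<^sup>+x. u x \<partial>Q) \<le> L u"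
    if u: "u \<in> borel_measurable P" "\<And>x. 0 \<le> u x" for u
    using u
  proof (induction rule: borel_measurable_induct_real)
    case (set A)
    then show ?case
      using em[of A] by (simp add: \<mu>_def setsQ ennreal_indicator)
  next
    case (mult u c)
    show ?case
    proof (cases "c = 0")
      case True
      then show ?thesis using zero by simp
    next
      case False
      show ?thesis
      proof
        assume "(\<lambda>x. c * u x) \<in> L_infty P"
        from VD(3)[OF this, of "1 / c"] have u: "u \<in> L_infty P" using False by simp
        have "(\<integral>\<^sup>+x. ennreal (c * u x) \<partial>Q) = ennreal c * (\<integral>\<^sup>+x. ennreal (u x) \<partial>Q)"
          using mult setsQ by (simp add: ennreal_mult nn_integral_cmult cong: measurable_cong_sets)
        also have "\<dots> \<le> ennreal c * ennreal (L u)"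
          using mult u by (intro mult_left_mono) auto
        also have "\<dots> = ennreal (L (\<lambda>x. c * u x))"
          using LD(2)[OF u] mult pos[OF u] by (simp add: ennreal_mult)
        finally show "(\<integral>\<^sup>+x. ennreal (c * u x) \<partial>Q) \<le> ennreal (L (\<lambda>x. c * u x))" .
      qed
    qed
  next
    case (add u v)
    show ?case
    proof
      assume uv: "(\<lambda>x. v x + u x) \<in> L_infty P"
      have u: "u \<in> L_infty P" by (rule L_infty_mono[OF uv]) (use add in auto)
      have v: "v \<in> L_infty P" by (rule L_infty_mono[OF uv]) (use add in auto)
      have "(\<integral>\<^sup>+x. ennreal (v x + u x) \<partial>Q) = (\<integral>\<^sup>+x. v x \<partial>Q) + (\<integral>\<^sup>+x. u x \<partial>Q)"
        using add setsQ by (simp add: ennreal_plus nn_integral_add cong: measurable_cong_sets)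
      also have "\<dots> \<le> ennreal (L v) + ennreal (L u)"
        using add u v by (intro add_mono) auto
      also have "\<dots> = ennreal (L (\<lambda>x. v x + u x))"
        using LD(1)[OF v u] pos[OF u] pos[OF v] add by (simp add: ennreal_plus)
      finally show "(\<integral>\<^sup>+x. ennreal (v x + u x) \<partial>Q) \<le> ennreal (L (\<lambda>x. v x + u x))" .
    qed
  next
    case (seq U)
    show ?case
    proof
      assume u: "u \<in> L_infty P"
      have le: "U i x \<le> u x" if "x \<in> space P" for i x
        using seq that by (intro incseq_le) (auto simp: incseq_def le_fun_def)
      have Ui: "U i \<in> L_infty P" for i
        by (rule L_infty_mono[OF u]) (use seq le in auto)
      have "(\<integral>\<^sup>+x. u x \<partial>Q) = (\<integral>\<^sup>+x. (SUP i. ennreal (U i x)) \<partial>Q)"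
      proof (rule nn_integral_cong)
        fix x assume "x \<in> space Q"
        then have "(\<lambda>i. ennreal (U i x)) \<longlonglongrightarrow> u x"
          using seq.hyps(4) by (intro tendsto_ennrealI) (simp add: spaceQ)
        moreover have "incseq (\<lambda>i. ennreal (U i x))"
          using seq.hyps(3) by (auto simp: incseq_def le_fun_def intro: ennreal_leI)
        ultimately show "ennreal (u x) = (SUP i. ennreal (U i x))"
          by (metis LIMSEQ_SUP LIMSEQ_unique)
      qed
      also have "\<dots> = (SUP i. \<integral>\<^sup>+x. U i x \<partial>Q)"
        using seq setsQ
        by (intro nn_integral_monotone_convergence_SUP)
           (auto simp: incseq_def le_fun_def intro: ennreal_leI cong: measurable_cong_sets)
      also have "\<dots> \<le> L u"
      proof (rule SUP_least)
        fix i
        have "(\<integral>\<^sup>+x. U i x \<partial>Q) \<le> L (U i)" using seq.IH Ui by simp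
        also have "\<dots> \<le> L u"
          using mono[OF Ui u] le by (auto intro!: ennreal_leI)
        finally show "(\<integral>\<^sup>+x. U i x \<partial>Q) \<le> L u" .
      qed
      finally show "(\<integral>\<^sup>+x. u x \<partial>Q) \<le> L u" .
    qed
  qed
  have "(\<integral>\<^sup>+x. f x \<partial>Q) \<le> L f" if f: "f \<in> L_infty P" and f0: "AE x in P. 0 \<le> f x" for f
  proof -
    have [measurable]: "f \<in> borel_measurable P" using f unfolding L_infty_def by blast
    obtain c where c: "AE x in P. \<bar>f x\<bar> \<le> c" using f unfolding L_infty_def by blast
    have "AE x in P. \<bar>max 0 (f x)\<bar> \<le> c" using c by eventually_elim auto
    then have f': "(\<lambda>x. max 0 (f x)) \<in> L_infty P" unfolding L_infty_def by auto
    have "(\<integral>\<^sup>+x. f x \<partial>Q) = (\<integral>\<^sup>+x. max 0 (f x) \<partial>Q)"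
      by (intro nn_integral_cong) (simp add: max_def ennreal_neg)
    also have "\<dots> \<le> L (\<lambda>x. max 0 (f x))"
      using int[of "\<lambda>x. max 0 (f x)"] f' by simp
    also have "L (\<lambda>x. max 0 (f x)) = L f"
      using f0 by (intro cong f f') (auto elim: eventually_mono)
    finally show ?thesis .
  qed
  then show ?thesis using prob setsQ ac meas by blast
qed

section \<open>Equivalent measures, integrability, and the convex set of test claims\<close>

lemma U2_concave:
  assumes "u \<in> U2" and "0 < s" and "0 < t" and "s + t = 1"
  shows "s * u x + t * u y \<le> u (s * x + t * y)"
  using assms unfolding U2_def by (auto simp: concave_on_iff)

lemma equivalent_probsD:
  assumes "Q \<in> equivalent_probs P"
  shows "prob_space Q" and "sets Q = sets P" and "space Q = space P"
    and "absolutely_continuous P Q" and "absolutely_continuous Q P"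
  using assms sets_eq_imp_space_eq unfolding equivalent_probs_def by auto

lemma absolutely_continuous_AE':
  assumes "sets Q = sets P" and "absolutely_continuous P Q" and "AE x in P. A x"
  shows "AE x in Q. A x"
  using assms absolutely_continuous_AE by blast

text \<open>A monotone function is Borel and bounded on bounded intervals. This one fact covers the
  utility, the loss function and, with the identity, bounded claims themselves.\<close>

lemma integrable_mono_L_infty:
  assumes R: "R \<in> equivalent_probs P" and h: "mono (h :: real \<Rightarrow> real)" and y: "y \<in> L_infty P"
  shows "integrable R (\<lambda>x. h (y x))"
proof -
  interpret prob_space R using equivalent_probsD(1)[OF R] .
  note RD = equivalent_probsD[OF R]
  have [measurable]: "y \<in> borel_measurable R"
    using y RD(2) unfolding L_infty_def by (simp cong: measurable_cong_sets)
  have [measurable]: "h \<in> borel_measurable borel"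
    by (rule borel_measurable_mono[OF h])
  obtain c where "AE x in P. \<bar>y x\<bar> \<le> c" using y unfolding L_infty_def by blast
  then have "AE x in R. \<bar>y x\<bar> \<le> c"
    by (rule absolutely_continuous_AE'[OF RD(2,4)])
  then have "AE x in R. norm (h (y x)) \<le> max \<bar>h c\<bar> \<bar>h (- c)\<bar>"
  proof eventually_elim
    case (elim x)
    then have "h (- c) \<le> h (y x)" "h (y x) \<le> h c"
      using h by (auto intro: monoD)
    then show ?case by auto
  qed
  then show ?thesis by (rule integrable_const_bound) measurable
qed

lemma D_set_convex:
  assumes P: "prob_space P" and v: "v \<in> D_set \<epsilon> P" and w: "w \<in> D_set \<epsilon> P"
    and st: "0 < s" "0 < t" "s + t = 1"
  shows "(\<lambda>x. s * v x + t * w x) \<in> D_set \<epsilon> P"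
proof -
  interpret prob_space P by fact
  note VD = fun_subspaceD[OF fun_subspace_L_infty]
  have *: "v \<in> L_infty P" "w \<in> L_infty P" "AE x in P. 0 \<le> v x \<and> v x \<le> 1" "AE x in P. 0 \<le> w x \<and> w x \<le> 1"
    "\<epsilon> \<le> (\<integral>x. v x \<partial>P)" "\<epsilon> \<le> (\<integral>x. w x \<partial>P)"
    using v w unfolding D_set_def by auto
  have int: "integrable P f" if "f \<in> L_infty P" for f
    using integrable_mono_L_infty[of P P "\<lambda>x. x"] that P
    by (simp add: equivalent_probs_def absolutely_continuous_def mono_def)
  have "AE x in P. 0 \<le> s * v x + t * w x \<and> s * v x + t * w x \<le> 1"
    using *(3,4)
  proof eventually_elim
    case (elim x)
    then have "s * v x \<le> s * 1" "t * w x \<le> t * 1" "0 \<le> s * v x" "0 \<le> t * w x"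
      using st by (auto intro!: mult_left_mono)
    then show ?case using st(3) by auto
  qed
  moreover have "(\<lambda>x. s * v x + t * w x) \<in> L_infty P"
    using * by (intro VD)
  moreover have "\<epsilon> \<le> (\<integral>x. s * v x + t * w x \<partial>P)"
  proof -
    have "\<epsilon> = s * \<epsilon> + t * \<epsilon>" using st(3) by (simp flip: distrib_right)
    also have "\<dots> \<le> s * (\<integral>x. v x \<partial>P) + t * (\<integral>x. w x \<partial>P)"
      using * st by (intro add_mono mult_left_mono) auto
    also have "\<dots> = (\<integral>x. s * v x + t * w x \<partial>P)"
      using int * by simp
    finally show ?thesis .
  qed
  ultimately show ?thesis unfolding D_set_def by blast
qed

lemma indicator_in_D_set:
  assumes "prob_space P" and "A \<in> sets P" and "\<epsilon> \<le> measure P A"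
  shows "indicator A \<in> D_set \<epsilon> P"
  using assms L_infty_indicator[OF assms(2)] unfolding D_set_def by (auto simp: indicator_def)

lemma one_in_D_set:
  assumes "prob_space P" and "\<epsilon> \<le> 1"
  shows "(\<lambda>x. 1) \<in> D_set \<epsilon> P"
  using assms L_infty_const[of 1 P] unfolding D_set_def by (auto simp: prob_space.prob_space)

text \<open>The loss function \<open>\<lambda>s. max 0 (u 0 - u (- s))\<close> turns the bound on expected utilities into a
  convex minorisation on \<open>D - C\<close>; a linear functional below it is positive, and inherits from the loss
  function a modulus of absolute continuity with respect to \<open>R\<close>.\<close>

definition loss :: "(real \<Rightarrow> real) \<Rightarrow> real \<Rightarrow> real" where
  "loss u s = max 0 (u 0 - u (- s))"

lemma mono_loss:
  assumes "u \<in> U2"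
  shows "mono (loss u)"
proof (rule monoI)
  fix x y :: real assume "x \<le> y"
  then have "u (- y) \<le> u (- x)" using assms by (auto simp: U2_def intro: monoD)
  then show "loss u x \<le> loss u y" by (simp add: loss_def)
qed

lemma loss_convex:
  assumes u: "u \<in> U2" and st: "0 < s" "0 < t" "s + t = 1"
  shows "loss u (s * x + t * y) \<le> s * loss u x + t * loss u y"
proof -
  have "s * u (- x) + t * u (- y) \<le> u (- (s * x + t * y))"
    using U2_concave[OF u st, of "- x" "- y"] by simp
  moreover have "u 0 = s * u 0 + t * u 0" using st(3) by (simp flip: distrib_right)
  ultimately have "u 0 - u (- (s * x + t * y)) \<le> s * (u 0 - u (- x)) + t * (u 0 - u (- y))"
    by (simp add: right_diff_distrib)
  also have "\<dots> \<le> s * loss u x + t * loss u y"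
    using st unfolding loss_def by (intro add_mono mult_left_mono) auto
  finally show ?thesis
    using st unfolding loss_def[of u "s * x + t * y"] by (simp add: loss_def)
qed

lemma loss_nonneg: "0 \<le> loss u s" and loss_zero: "loss u 0 = 0"
  unfolding loss_def by simp_all

text \<open>At \<open>z = 0\<close> a decomposition \<open>z = y - w + f\<close> means
  \<open>- y = f - w\<close>, so the utility bound makes the expected loss of \<open>y\<close> at
  least \<delta>. Lowering heights by \<delta> therefore still leaves them nonnegative at the
  origin, which is what the linear minorant requires.\<close>

lemma separating_functional:
  assumes P: "prob_space P" and R: "R \<in> equivalent_probs P" and u: "u \<in> U2" and \<epsilon>: "\<epsilon> \<le> 1"
    and sub: "C \<subseteq> L_infty P"
    and add: "\<And>f g. f \<in> C \<Longrightarrow> g \<in> C \<Longrightarrow> (\<lambda>x. f x + g x) \<in> C"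
    and cmult: "\<And>f c. f \<in> C \<Longrightarrow> 0 < c \<Longrightarrow> (\<lambda>x. c * f x) \<in> C"
    and nonpos: "\<And>f. f \<in> L_infty P \<Longrightarrow> AE x in P. f x \<le> 0 \<Longrightarrow> f \<in> C"
    and bound: "\<And>f w. f \<in> C \<Longrightarrow> w \<in> D_set \<epsilon> P \<Longrightarrow> (\<integral>x. u (f x - w x) \<partial>R) \<le> u 0 - \<delta>"
  shows "\<exists>L. fun_linear (L_infty P) L \<and>
    (\<forall>y\<in>L_infty P. \<forall>w\<in>D_set \<epsilon> P. \<forall>f\<in>C.
      L (\<lambda>x. y x - w x + f x) \<le> (\<integral>x. loss u (y x) \<partial>R) - \<delta>)"
proof -
  note VD = fun_subspaceD[OF fun_subspace_L_infty]
  interpret R: prob_space R using equivalent_probsD(1)[OF R] .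
  have D: "w \<in> L_infty P" if "w \<in> D_set \<epsilon> P" for w using that unfolding D_set_def by blast
  have C: "f \<in> L_infty P" if "f \<in> C" for f using that sub by blast
  have 0: "(\<lambda>x. 0) \<in> C" using VD(1) by (intro nonpos) auto
  have int: "integrable R (\<lambda>x. loss u (y x))" if "y \<in> L_infty P" for y
    by (rule integrable_mono_L_infty[OF R mono_loss[OF u] that])
  define J where "J = (\<lambda>y. \<integral>x. loss u (y x) \<partial>R)"
  \<comment> \<open>These are the heights above the infimum of \<open>J y - \<delta>\<close> over
    all decompositions \<open>z = y - w + f\<close>. It is convex because the loss and D are convex
    and C is a convex cone.\<close>
  define E where "E = {(\<lambda>x. y x - w x + f x, a) | y w f a.
    y \<in> L_infty P \<and> w \<in> D_set \<epsilon> P \<and> f \<in> C \<and> J y - \<delta> \<le> a}"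
  have E_I: "(\<lambda>x. y x - w x + f x, a) \<in> E"
    if "y \<in> L_infty P" "w \<in> D_set \<epsilon> P" "f \<in> C" "J y - \<delta> \<le> a" for y w f a
    unfolding E_def using that by blast
  have "\<exists>L. fun_linear (L_infty P) L \<and> (\<forall>(z, a)\<in>E. L z \<le> a)"
  proof (rule convex_epigraph_linear_minorant[OF fun_subspace_L_infty])
    fix z a assume "(z, a) \<in> E"
    then obtain y w f where z: "z = (\<lambda>x. y x - w x + f x)" "y \<in> L_infty P" "w \<in> D_set \<epsilon> P" "f \<in> C"
      unfolding E_def by blast
    show "z \<in> L_infty P" unfolding z(1) by (intro VD z D C)
  next
    fix z a z' a' and s t :: real
    assume "(z, a) \<in> E" "(z', a') \<in> E" and st: "0 < s" "0 < t" "s + t = 1"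
    then obtain y w f y' w' f' where
      z: "z = (\<lambda>x. y x - w x + f x)" "y \<in> L_infty P" "w \<in> D_set \<epsilon> P" "f \<in> C" "J y - \<delta> \<le> a" and
      z': "z' = (\<lambda>x. y' x - w' x + f' x)" "y' \<in> L_infty P" "w' \<in> D_set \<epsilon> P" "f' \<in> C" "J y' - \<delta> \<le> a'"
      unfolding E_def by blast
    have yy: "(\<lambda>x. s * y x + t * y' x) \<in> L_infty P" using z z' by (intro VD)
    have "J (\<lambda>x. s * y x + t * y' x) \<le> (\<integral>x. s * loss u (y x) + t * loss u (y' x) \<partial>R)"
      unfolding J_def using int yy z(2) z'(2) loss_convex[OF u st] by (intro integral_mono) auto
    also have "\<dots> = s * J y + t * J y'"
      unfolding J_def using int z(2) z'(2) by simp
    finally have "J (\<lambda>x. s * y x + t * y' x) - \<delta> \<le> s * (J y - \<delta>) + t * (J y' - \<delta>)"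
      using distrib_right[of s t \<delta>] st(3) by (simp add: right_diff_distrib)
    also have "\<dots> \<le> s * a + t * a'"
      using z z' st by (intro add_mono mult_left_mono) auto
    finally have "(\<lambda>x. (s * y x + t * y' x) - (s * w x + t * w' x) + (s * f x + t * f' x), s * a + t * a') \<in> E"
      using z z' st yy by (intro E_I D_set_convex[OF P] add cmult) auto
    then show "(\<lambda>x. s * z x + t * z' x, s * a + t * a') \<in> E"
      unfolding z z' by (simp add: algebra_simps)
  next
    fix z assume z: "z \<in> L_infty P"
    \<comment> \<open>The expected loss is finite on all of \<open>L_infty\<close>, so every
      \<open>z\<close> is reached with \<open>t = 1\<close>, by adding and subtracting the claim
      \<open>1\<close> of D.\<close>
    have "(\<lambda>x. (z x + 1) - 1 + 0, J (\<lambda>x. z x + 1) - \<delta>) \<in> E"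
      using VD(2)[OF z L_infty_const] one_in_D_set[OF P \<epsilon>] 0 by (rule E_I) simp
    then show "\<exists>t>0. \<exists>a. (\<lambda>x. t * z x, a) \<in> E"
      by (intro exI[of _ 1]) auto
  next
    fix a assume "(\<lambda>x. 0, a) \<in> E"
    then obtain y w f where
      eq: "(\<lambda>x. 0) = (\<lambda>x. y x - w x + f x)" and
      *: "y \<in> L_infty P" "w \<in> D_set \<epsilon> P" "f \<in> C" "J y - \<delta> \<le> a"
      unfolding E_def by blast
    have y: "f x - w x = - y x" for x using fun_cong[OF eq, of x] by simp
    have "mono u" using u by (simp add: U2_def)
    from integrable_mono_L_infty[OF R this VD(4)[OF *(1)]]
    have iu: "integrable R (\<lambda>x. u (- y x))" .
    have "\<delta> \<le> u 0 - (\<integral>x. u (- y x) \<partial>R)"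
      using bound[OF *(3,2)] by (simp add: y)
    also have "\<dots> = (\<integral>x. u 0 - u (- y x) \<partial>R)"
      using iu by (simp add: R.prob_space)
    also have "\<dots> \<le> J y"
      unfolding J_def using iu int[OF *(1)] by (intro integral_mono) (auto simp: loss_def)
    finally show "0 \<le> a" using * by simp
  qed
  then obtain L where "fun_linear (L_infty P) L" "\<forall>(z, a)\<in>E. L z \<le> a" by blast
  then show ?thesis using E_I unfolding J_def by (intro exI[of _ L]) blast
qed

text \<open>The order of choices matters: \<open>t\<close> is fixed first, to make
  \<open>c / (\<delta> * t)\<close> small, and only then does \<open>r\<close> tend to 0. Hence
  \<open>l t\<close> may grow arbitrarily fast in \<open>t\<close>.\<close>

lemma modulus_tendsto_zero:
  fixes m r :: "nat \<Rightarrow> real" and l :: "real \<Rightarrow> real"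
  assumes r: "r \<longlonglongrightarrow> 0" and c: "0 \<le> c" and \<delta>: "0 < \<delta>" and m: "\<And>i. 0 \<le> m i"
    and le: "\<And>t. 0 < t \<Longrightarrow> eventually (\<lambda>i. m i \<le> (c + l t * r i) / (\<delta> * t)) sequentially"
  shows "m \<longlonglongrightarrow> 0"
proof (rule order_tendstoI)
  fix a :: real assume "a < 0"
  then show "eventually (\<lambda>i. a < m i) sequentially"
    using m by (intro always_eventually allI) (rule less_le_trans)
next
  fix a :: real assume a: "0 < a"
  \<comment> \<open>For this \<open>t\<close> the limit of the bound is
    \<open>a * c / (c + 1)\<close>, strictly below \<open>a\<close>; the summand 1 also keeps
    \<open>t\<close> positive when \<open>c = 0\<close>.\<close>
  define t where "t = (c + 1) / (\<delta> * a)"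
  have t: "0 < t" using a \<delta> c unfolding t_def by simp
  have "(\<lambda>i. (c + l t * r i) / (\<delta> * t)) \<longlonglongrightarrow> (c + l t * 0) / (\<delta> * t)"
    using t \<delta> by (intro tendsto_intros r) auto
  moreover have "(c + l t * 0) / (\<delta> * t) < a"
  proof -
    have "\<delta> * t = (c + 1) / a" using \<delta> by (simp add: t_def)
    then show ?thesis using a c by (simp add: divide_less_eq)
  qed
  ultimately have "eventually (\<lambda>i. (c + l t * r i) / (\<delta> * t) < a) sequentially"
    by (rule order_tendstoD)
  then show "eventually (\<lambda>i. m i < a) sequentially"
    using le[OF t] by eventually_elim simp
qed

text \<open>The measure is \<open>L\<close> divided by its mass \<open>\<Lambda> = L 1\<close>.
  Testing with \<open>y = 0\<close> gives \<open>L \<ge> \<delta>\<close> on D, hence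
  \<open>\<delta> \<le> \<Lambda>\<close>, and by scaling in the cone \<open>L \<le> 0\<close> on C.
  Since C contains the nonpositive bounded functions, \<open>L\<close> is positive. The upper bound
  \<open>\<Lambda> \<le> loss u 2\<close> then keeps the normalised mass of large events at least
  \<open>\<delta> / loss u 2\<close>.\<close>

lemma separating_measure:
  assumes P: "prob_space P" and R: "R \<in> equivalent_probs P" and u: "u \<in> U2" and \<epsilon>: "\<epsilon> \<le> 1" and \<delta>: "0 < \<delta>"
    and sub: "C \<subseteq> L_infty P"
    and add: "\<And>f g. f \<in> C \<Longrightarrow> g \<in> C \<Longrightarrow> (\<lambda>x. f x + g x) \<in> C"
    and cmult: "\<And>f c. f \<in> C \<Longrightarrow> 0 < c \<Longrightarrow> (\<lambda>x. c * f x) \<in> C"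
    and nonpos: "\<And>f. f \<in> L_infty P \<Longrightarrow> AE x in P. f x \<le> 0 \<Longrightarrow> f \<in> C"
    and bound: "\<And>f w. f \<in> C \<Longrightarrow> w \<in> D_set \<epsilon> P \<Longrightarrow> (\<integral>x. u (f x - w x) \<partial>R) \<le> u 0 - \<delta>"
  shows "\<exists>Q. prob_space Q \<and> sets Q = sets P \<and> absolutely_continuous P Q \<and>
    (\<forall>f\<in>C. \<forall>a. (AE x in P. - a \<le> f x) \<longrightarrow> (\<integral>\<^sup>+x. ennreal (f x + a) \<partial>Q) \<le> ennreal a) \<and>
    (\<forall>A\<in>sets P. \<epsilon> \<le> measure P A \<longrightarrow> \<delta> / loss u 2 \<le> measure Q A) \<and>
    (\<forall>A\<in>sets P. \<forall>t>0. measure Q A \<le> (loss u 2 + loss u t * measure R A) / (\<delta> * t))"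
proof -
  note VD = fun_subspaceD[OF fun_subspace_L_infty]
  interpret R: prob_space R using equivalent_probsD(1)[OF R] .
  note RD = equivalent_probsD[OF R]
  obtain L where L: "fun_linear (L_infty P) L" and
    le: "\<And>y w f. y \<in> L_infty P \<Longrightarrow> w \<in> D_set \<epsilon> P \<Longrightarrow> f \<in> C \<Longrightarrow>
      L (\<lambda>x. y x - w x + f x) \<le> (\<integral>x. loss u (y x) \<partial>R) - \<delta>"
    using separating_functional[OF P R u \<epsilon> sub add cmult nonpos bound] by blast
  note LD = fun_linearD[OF L]
  have D: "w \<in> L_infty P" if "w \<in> D_set \<epsilon> P" for w using that unfolding D_set_def by blast
  have C: "f \<in> L_infty P" if "f \<in> C" for f using that sub by blast
  have minus: "L (\<lambda>x. - f x) = - L f" if "f \<in> L_infty P" for f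
    using LD(2)[OF that, of "-1"] by simp
  have L0: "L (\<lambda>x. 0) = 0" using LD(2)[OF VD(1), of 0] by simp
  have 0: "(\<lambda>x. 0) \<in> C" using VD(1) by (intro nonpos) auto
  define \<Lambda> where "\<Lambda> = L (\<lambda>x. 1)"
  have le': "L y - L w + L f \<le> (\<integral>x. loss u (y x) \<partial>R) - \<delta>"
    if "y \<in> L_infty P" "w \<in> D_set \<epsilon> P" "f \<in> C" for y w f
  proof -
    note V = that(1) VD(4)[OF D[OF that(2)]] C[OF that(3)]
    have "L (\<lambda>x. y x + - w x + f x) = L y + L (\<lambda>x. - w x) + L f"
      using LD(1)[OF VD(2)[OF V(1,2)] V(3)] LD(1)[OF V(1,2)] by simp
    then show ?thesis using le[OF that] minus[OF D[OF that(2)]] by simp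
  qed
  have Dge: "\<delta> \<le> L w" if "w \<in> D_set \<epsilon> P" for w
    using le'[OF VD(1) that 0] L0 by (simp add: loss_zero)
  then have \<Lambda>: "\<delta> \<le> \<Lambda>" unfolding \<Lambda>_def using one_in_D_set[OF P \<epsilon>] by blast
  have Cle: "L f \<le> 0" if f: "f \<in> C" for f
  proof (rule ccontr)
    assume "\<not> L f \<le> 0"
    then have Lf: "0 < L f" by simp
    \<comment> \<open>Scaling makes \<open>L (c * f)\<close> equal to \<open>\<Lambda>\<close>,
      which cancels \<open>L 1\<close> in the separation inequality with \<open>y = 0\<close> and
      \<open>w = 1\<close> and leaves \<open>0 \<le> - \<delta>\<close>.\<close>
    define c where "c = \<Lambda> / L f"
    have c: "0 < c" using \<Lambda> \<delta> Lf unfolding c_def by simp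
    have "L (\<lambda>x. c * f x) = \<Lambda>"
      using LD(2)[OF C[OF f], of c] Lf by (simp add: c_def)
    then show False
      using le'[OF VD(1) one_in_D_set[OF P \<epsilon>] cmult[OF f c]] L0 \<delta> by (simp add: loss_zero \<Lambda>_def)
  qed
  have key: "t * L (indicator A) \<le> \<Lambda> + loss u t * measure R A - \<delta>" if A: "A \<in> sets P" for t A
  proof -
    have "(\<integral>x. loss u (t * indicator A x) \<partial>R) = (\<integral>x. loss u t * indicator A x \<partial>R)"
      by (intro Bochner_Integration.integral_cong) (auto simp: indicator_def loss_zero)
    then show ?thesis
      using le'[OF VD(3)[OF L_infty_indicator[OF A], of t] one_in_D_set[OF P \<epsilon>] 0]
        LD(2)[OF L_infty_indicator[OF A]] L0 A RD(2) by (simp add: \<Lambda>_def)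
  qed
  \<comment> \<open>A constant \<open>y = s\<close> with \<open>w = 1\<close> gives
    \<open>(s - 1) * \<Lambda> \<le> loss u s - \<delta>\<close>; the value 2 makes the factor equal
    to 1 and is the source of \<open>loss u 2\<close> everywhere below.\<close>
  have \<Lambda>_le: "\<Lambda> \<le> loss u 2 - \<delta>"
  proof -
    have "\<Lambda> * 2 \<le> \<Lambda> + loss u 2 - \<delta>"
      using le'[OF L_infty_const[of 2] one_in_D_set[OF P \<epsilon>] 0] LD(2)[OF L_infty_const[of 1], of 2] L0
      by (simp add: \<Lambda>_def R.prob_space)
    then show ?thesis by simp
  qed
  have \<Lambda>0: "0 < \<Lambda>" using \<Lambda> \<delta> by simp
  have L_nonneg: "0 \<le> L f" if f: "f \<in> L_infty P" and "AE x in P. 0 \<le> f x" for f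
    using Cle[OF nonpos[OF VD(4)[OF f]]] that minus[OF f] by auto
  \<comment> \<open>Since \<open>\<Lambda> \<ge> \<delta>\<close>, normalising costs at most the
    factor \<open>1 / \<delta>\<close>; the remaining constants depend on \<open>u\<close> and
    \<delta> but not on the market.\<close>
  have modulus: "L (indicator A) / \<Lambda> \<le> (loss u 2 + loss u t * measure R A) / (\<delta> * t)"
    if A: "A \<in> sets P" and t: "0 < t" for A t
  proof -
    have "t * L (indicator A) \<le> loss u 2 + loss u t * measure R A"
      using key[OF A, of t] \<Lambda>_le \<delta> by simp
    then have "L (indicator A) \<le> (loss u 2 + loss u t * measure R A) / t"
      using t by (simp add: field_simps)
    moreover have "0 \<le> L (indicator A)" by (intro L_nonneg L_infty_indicator A) simp
    ultimately have "L (indicator A) / \<Lambda> \<le> ((loss u 2 + loss u t * measure R A) / t) / \<delta>"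
      using \<Lambda> \<delta> by (intro frac_le) auto
    then show ?thesis by (simp add: mult.commute)
  qed
  define L' where "L' = (\<lambda>f. L f / \<Lambda>)"
  have "\<exists>Q. prob_space Q \<and> sets Q = sets P \<and> absolutely_continuous P Q \<and>
    (\<forall>A\<in>sets P. measure Q A = L' (indicator A)) \<and>
    (\<forall>f\<in>L_infty P. (AE x in P. 0 \<le> f x) \<longrightarrow> (\<integral>\<^sup>+x. f x \<partial>Q) \<le> L' f)"
  proof (rule positive_functional_measure[OF P])
    show "fun_linear (L_infty P) L'"
      using LD unfolding fun_linear_def L'_def by (simp add: add_divide_distrib)
    show "L' (\<lambda>x. 1) = 1" using \<Lambda>0 by (simp add: L'_def flip: \<Lambda>_def)
    show "0 \<le> L' f" if "f \<in> L_infty P" "AE x in P. 0 \<le> f x" for f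
      using L_nonneg[OF that] \<Lambda>0 by (simp add: L'_def)
    fix A :: "nat \<Rightarrow> 'a set"
    assume A: "range A \<subseteq> sets P" "decseq A" "(\<Inter>i. A i) = {}"
    have Ai: "A i \<in> sets P" for i using A(1) by blast
    have lim: "(\<lambda>i. measure R (A i)) \<longlonglongrightarrow> 0"
      using R.finite_Lim_measure_decseq[of A] A RD(2) by simp
    show "(\<lambda>i. L' (indicator (A i))) \<longlonglongrightarrow> 0"
    proof (rule modulus_tendsto_zero[OF lim loss_nonneg \<delta>])
      show "0 \<le> L' (indicator (A i))" for i
        unfolding L'_def using \<Lambda>0 by (intro divide_nonneg_pos L_nonneg L_infty_indicator Ai) auto
      show "eventually (\<lambda>i. L' (indicator (A i)) \<le> (loss u 2 + loss u t * measure R (A i)) / (\<delta> * t)) sequentially"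
        if "0 < t" for t
        unfolding L'_def by (intro always_eventually allI modulus Ai that)
    qed
  qed
  then obtain Q where Q: "prob_space Q" "sets Q = sets P" "absolutely_continuous P Q"
    and QL: "\<And>A. A \<in> sets P \<Longrightarrow> measure Q A = L' (indicator A)"
    and Qint: "\<And>f. f \<in> L_infty P \<Longrightarrow> AE x in P. 0 \<le> f x \<Longrightarrow> (\<integral>\<^sup>+x. f x \<partial>Q) \<le> L' f"
    by blast
  have "(\<integral>\<^sup>+x. ennreal (f x + a) \<partial>Q) \<le> ennreal a" if f: "f \<in> C" and a: "AE x in P. - a \<le> f x" for f a
  proof -
    have "(\<integral>\<^sup>+x. ennreal (f x + a) \<partial>Q) \<le> L' (\<lambda>x. f x + a)"
      using a VD(2)[OF C[OF f] L_infty_const[of a]] by (intro Qint) (auto elim: eventually_mono)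
    also have "L' (\<lambda>x. f x + a) = (L f + a * \<Lambda>) / \<Lambda>"
      using LD(1)[OF C[OF f] L_infty_const[of a]] LD(2)[OF L_infty_const[of 1], of a]
      by (simp add: L'_def \<Lambda>_def)
    also have "\<dots> \<le> a"
      using Cle[OF f] \<Lambda>0 by (simp add: divide_le_eq)
    finally show ?thesis by (simp add: ennreal_leI)
  qed
  moreover have "\<delta> / loss u 2 \<le> measure Q A" if A: "A \<in> sets P" "\<epsilon> \<le> measure P A" for A
    using Dge[OF indicator_in_D_set[OF P A]] \<Lambda>_le \<Lambda>0 \<delta> unfolding QL[OF A(1)] L'_def
    by (intro frac_le) auto
  moreover have "measure Q A \<le> (loss u 2 + loss u t * measure R A) / (\<delta> * t)"
    if "A \<in> sets P" "0 < t" for A t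
    using modulus[OF that] QL[OF that(1)] by (simp add: L'_def)
  ultimately show ?thesis using Q by blast
qed

section \<open>Separating measures of one market\<close>

lemma market_modelD:
  assumes "market_model P F d S"
  shows "prob_space P" and "filtered_prob_space P F"
    and "j < d \<Longrightarrow> adapted_cadlag P F (\<lambda>t \<omega>. S t \<omega> j)"
  using assms
  unfolding market_model_def semimartingale_vec_def semimartingale_def filtered_prob_space_def
  by blast+

lemma C_set_I:
  assumes "f \<in> L_infty P" and "k \<in> K_set P F d S" and "AE x in P. f x \<le> k x"
  shows "f \<in> C_set P F d S"
proof -
  have "(\<lambda>x. k x - f x) \<in> L0_plus P"
    using assms by (auto simp: L0_plus_def K_set_def L_infty_def)
  then show ?thesis
    unfolding C_set_def using assms(1,2)
    by (intro CollectI conjI bexI[of _ "\<lambda>x. k x - f x"] bexI[of _ k]) auto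
qed

lemma C_set_E:
  assumes "f \<in> C_set P F d S"
  obtains k where "f \<in> L_infty P" and "k \<in> K_set P F d S" and "AE x in P. f x \<le> k x"
proof -
  obtain k h where "f \<in> L_infty P" "k \<in> K_set P F d S" "h \<in> L0_plus P" "AE x in P. f x = k x - h x"
    using assms unfolding C_set_def by blast
  moreover have "AE x in P. f x \<le> k x"
    using calculation(3,4) unfolding L0_plus_def by (auto elim: eventually_elim2)
  ultimately show thesis using that by blast
qed

lemma C_set_nonpos: "f \<in> L_infty P \<Longrightarrow> AE x in P. f x \<le> 0 \<Longrightarrow> f \<in> C_set P F d S"
  by (rule C_set_I[OF _ zero_in_K_set])

lemma C_set_add:
  assumes "market_model P F d S" and f: "f \<in> C_set P F d S" and g: "g \<in> C_set P F d S"
  shows "(\<lambda>x. f x + g x) \<in> C_set P F d S"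
proof -
  obtain k where k: "f \<in> L_infty P" "k \<in> K_set P F d S" "AE x in P. f x \<le> k x"
    using f by (rule C_set_E)
  obtain l where l: "g \<in> L_infty P" "l \<in> K_set P F d S" "AE x in P. g x \<le> l x"
    using g by (rule C_set_E)
  have "(\<lambda>x. k x + l x) \<in> K_set P F d S"
    using K_set_add[OF market_modelD(2,3)[OF assms(1)] k(2) l(2)] .
  moreover have "AE x in P. f x + g x \<le> k x + l x"
    using k(3) l(3) by eventually_elim simp
  ultimately show ?thesis
    using fun_subspaceD(2)[OF fun_subspace_L_infty k(1) l(1)] by (intro C_set_I)
qed

lemma C_set_cmult:
  assumes "market_model P F d S" and f: "f \<in> C_set P F d S" and c: "0 < c"
  shows "(\<lambda>x. c * f x) \<in> C_set P F d S"
proof -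
  obtain k where k: "f \<in> L_infty P" "k \<in> K_set P F d S" "AE x in P. f x \<le> k x"
    using f by (rule C_set_E)
  have "(\<lambda>x. c * k x) \<in> K_set P F d S"
    using K_set_cmult[OF market_modelD(2,3)[OF assms(1)] k(2) c] .
  moreover have "AE x in P. c * f x \<le> c * k x"
    using k(3) by eventually_elim (use c in simp)
  ultimately show ?thesis
    using fun_subspaceD(3)[OF fun_subspace_L_infty k(1)] by (intro C_set_I)
qed

text \<open>Terminal gains are bounded below but possibly not above, so they reach C only after
  truncation; monotone convergence later removes the truncation.\<close>

lemma K_set_truncate:
  assumes f: "f \<in> K_set P F d S"
  shows "(\<lambda>x. min (f x) b) \<in> C_set P F d S"
proof (rule C_set_I[OF _ f])
  obtain a where a: "AE x in P. - a \<le> f x" using K_set_bounded_below[OF f] by blast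
  have [measurable]: "f \<in> borel_measurable P" using f by (simp add: K_set_def)
  have "AE x in P. \<bar>min (f x) b\<bar> \<le> \<bar>a\<bar> + \<bar>b\<bar>" using a by eventually_elim auto
  then show "(\<lambda>x. min (f x) b) \<in> L_infty P" unfolding L_infty_def by auto
qed simp

text \<open>In this form, with nonnegative integrals only, membership in \<open>M_set\<close> is visibly stable under mixtures.\<close>

lemma M_set_iff:
  assumes Q: "prob_space Q" "sets Q = sets P" "absolutely_continuous P Q"
  shows "Q \<in> M_set P F d S \<longleftrightarrow> (\<forall>f\<in>K_set P F d S. \<forall>a\<ge>0. (AE x in P. - a \<le> f x) \<longrightarrow>
    (\<integral>\<^sup>+x. ennreal (f x + a) \<partial>Q) \<le> ennreal a)"
proof -
  interpret prob_space Q by fact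
  have K: "f \<in> borel_measurable Q" if "f \<in> K_set P F d S" for f
    using that Q(2) by (simp add: K_set_def cong: measurable_cong_sets)
  have eq: "(\<integral>\<^sup>+x. ennreal (f x + a) \<partial>Q) = ennreal ((\<integral>x. f x \<partial>Q) + a)"
    if "integrable Q f" "AE x in P. - a \<le> f x" for f a
  proof -
    have "AE x in Q. - a \<le> f x"
      by (rule absolutely_continuous_AE'[OF Q(2,3) that(2)])
    then have *: "AE x in Q. 0 \<le> f x + a" by eventually_elim simp
    have "(\<integral>x. f x + a \<partial>Q) = (\<integral>x. f x \<partial>Q) + a" using that(1) by (simp add: prob_space)
    then show "(\<integral>\<^sup>+x. ennreal (f x + a) \<partial>Q) = ennreal ((\<integral>x. f x \<partial>Q) + a)"
      using nn_integral_eq_integral[of Q "\<lambda>x. f x + a"] that(1) * by auto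
  qed
  show ?thesis
  proof (intro iffI ballI allI impI)
    fix f a assume "Q \<in> M_set P F d S" "f \<in> K_set P F d S" and a: "AE x in P. - a \<le> f x"
    then have f: "integrable Q f" "(\<integral>x. f x \<partial>Q) \<le> 0" unfolding M_set_def by auto
    then show "(\<integral>\<^sup>+x. ennreal (f x + a) \<partial>Q) \<le> ennreal a" unfolding eq[OF f(1) a] by (intro ennreal_leI) simp
  next
    assume *: "\<forall>f\<in>K_set P F d S. \<forall>a\<ge>0. (AE x in P. - a \<le> f x) \<longrightarrow> (\<integral>\<^sup>+x. ennreal (f x + a) \<partial>Q) \<le> ennreal a"
    have "integrable Q f \<and> (\<integral>x. f x \<partial>Q) \<le> 0" if f: "f \<in> K_set P F d S" for f
    proof -
      obtain a where a: "0 \<le> a" "AE x in P. - a \<le> f x" using K_set_bounded_below[OF f] by blast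
      have le: "(\<integral>\<^sup>+x. ennreal (f x + a) \<partial>Q) \<le> ennreal a" using * f a by blast
      have "AE x in Q. - a \<le> f x"
        by (rule absolutely_continuous_AE'[OF Q(2,3) a(2)])
      then have "AE x in Q. 0 \<le> f x + a" by eventually_elim simp
      then have "integrable Q (\<lambda>x. f x + a)"
        using K[OF f] le by (intro integrableI_nonneg) (auto intro: le_less_trans)
      from Bochner_Integration.integrable_diff[OF this integrable_const[of a]]
      have int: "integrable Q f" by simp
      have "ennreal ((\<integral>x. f x \<partial>Q) + a) \<le> ennreal a" using le unfolding eq[OF int a(2)] .
      then show ?thesis using int a(1) by simp
    qed
    then show "Q \<in> M_set P F d S" unfolding M_set_def using Q by blast
  qed
qed

lemma M_set_C_set_integral:
  assumes Q: "Q \<in> M_set P F d S" "Q \<in> equivalent_probs P" and f: "f \<in> C_set P F d S"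
  shows "integrable Q f" and "(\<integral>x. f x \<partial>Q) \<le> 0"
proof -
  obtain k where k: "f \<in> L_infty P" "k \<in> K_set P F d S" "AE x in P. f x \<le> k x"
    using f by (rule C_set_E)
  show int: "integrable Q f"
    using integrable_mono_L_infty[OF Q(2) _ k(1), of "\<lambda>x. x"] by (simp add: mono_def)
  have kk: "integrable Q k" "(\<integral>x. k x \<partial>Q) \<le> 0" using Q(1) k(2) unfolding M_set_def by auto
  have "(\<integral>x. f x \<partial>Q) \<le> (\<integral>x. k x \<partial>Q)"
    using absolutely_continuous_AE'[OF equivalent_probsD(2,4)[OF Q(2)] k(3)]
    by (intro integral_mono_AE int kk)
  then show "(\<integral>x. f x \<partial>Q) \<le> 0" using kk(2) by simp
qed

lemma market_separating_measure:
  assumes market: "market_model P F d S" and R: "R \<in> equivalent_probs P" and u: "u \<in> U2"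
    and \<epsilon>: "\<epsilon> \<le> 1" and \<delta>: "0 < \<delta>"
    and bound: "\<And>f w. f \<in> C_set P F d S \<Longrightarrow> w \<in> D_set \<epsilon> P \<Longrightarrow> (\<integral>x. u (f x - w x) \<partial>R) \<le> u 0 - \<delta>"
  shows "\<exists>Q\<in>M_set P F d S.
    (\<forall>A\<in>sets P. \<epsilon> \<le> measure P A \<longrightarrow> \<delta> / loss u 2 \<le> measure Q A) \<and>
    (\<forall>A\<in>sets P. \<forall>t>0. measure Q A \<le> (loss u 2 + loss u t * measure R A) / (\<delta> * t))"
proof -
  have "C_set P F d S \<subseteq> L_infty P" unfolding C_set_def by blast
  from separating_measure[OF market_modelD(1)[OF market] R u \<epsilon> \<delta> this C_set_add[OF market]
      C_set_cmult[OF market] C_set_nonpos bound]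
  obtain Q where Q: "prob_space Q" "sets Q = sets P" "absolutely_continuous P Q" and
    C: "\<And>f a. f \<in> C_set P F d S \<Longrightarrow> AE x in P. - a \<le> f x \<Longrightarrow> (\<integral>\<^sup>+x. ennreal (f x + a) \<partial>Q) \<le> ennreal a" and
    QA: "\<forall>A\<in>sets P. \<epsilon> \<le> measure P A \<longrightarrow> \<delta> / loss u 2 \<le> measure Q A"
      "\<forall>A\<in>sets P. \<forall>t>0. measure Q A \<le> (loss u 2 + loss u t * measure R A) / (\<delta> * t)"
    by blast
  have "(\<integral>\<^sup>+x. ennreal (f x + a) \<partial>Q) \<le> ennreal a"
    if f: "f \<in> K_set P F d S" and a: "0 \<le> a" "AE x in P. - a \<le> f x" for f a
  proof -
    have [measurable]: "f \<in> borel_measurable Q"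
      using f Q(2) by (simp add: K_set_def cong: measurable_cong_sets)
    \<comment> \<open>The bound known on C is applied to the truncations of \<open>f\<close> and
      passed to the limit. They keep the lower bound \<open>- a\<close> because the levels are
      nonnegative and \<open>a \<ge> 0\<close>.\<close>
    have "ennreal (f x + a) = (SUP n. ennreal (min (f x) (real n) + a))" for x
    proof (rule antisym)
      obtain n :: nat where "f x \<le> real n" using real_arch_simple by blast
      then show "ennreal (f x + a) \<le> (SUP n. ennreal (min (f x) (real n) + a))"
        by (intro SUP_upper2[of n]) auto
    qed (auto intro!: SUP_least ennreal_leI)
    then have "(\<integral>\<^sup>+x. ennreal (f x + a) \<partial>Q) = (\<integral>\<^sup>+x. (SUP n. ennreal (min (f x) (real n) + a)) \<partial>Q)"
      by simp
    also have "\<dots> = (SUP n. \<integral>\<^sup>+x. ennreal (min (f x) (real n) + a) \<partial>Q)"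
      by (intro nn_integral_monotone_convergence_SUP)
         (auto simp: incseq_def le_fun_def intro!: ennreal_leI min.mono)
    also have "\<dots> \<le> a"
    proof (rule SUP_least)
      fix n :: nat
      have "AE x in P. - a \<le> min (f x) (real n)"
        using a(2) by eventually_elim (use a(1) in auto)
      then show "(\<integral>\<^sup>+x. ennreal (min (f x) (real n) + a) \<partial>Q) \<le> ennreal a"
        by (rule C[OF K_set_truncate[OF f]])
    qed
    finally show ?thesis .
  qed
  then have "Q \<in> M_set P F d S" unfolding M_set_iff[OF Q] by blast
  then show ?thesis using QA by blast
qed

section \<open>Mixtures and contiguity\<close>

context
  fixes P :: "'a measure" and Q :: "nat \<Rightarrow> 'a measure" and p :: "nat pmf"
  assumes Q: "\<And>k. prob_space (Q k)" "\<And>k. sets (Q k) = sets P"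
begin

lemma mixture_kernel: "Q \<in> measurable (measure_pmf p) (subprob_algebra P)"
  using Q by (auto simp: space_subprob_algebra prob_space_imp_subprob_space)

lemma mixture_prob_space: "prob_space (measure_pmf p \<bind> Q)"
  using measure_pmf.prob_space_bind[OF _ mixture_kernel] Q(1) by simp

lemma sets_mixture: "sets (measure_pmf p \<bind> Q) = sets P"
  using Q(2) by (intro sets_bind) auto

lemma measure_mixture: "A \<in> sets P \<Longrightarrow> measure (measure_pmf p \<bind> Q) A = (\<integral>k. measure (Q k) A \<partial>measure_pmf p)"
  by (rule measure_pmf.measure_bind[OF mixture_kernel])

lemma measure_mixture_ge:
  assumes A: "A \<in> sets P"
  shows "pmf p k * measure (Q k) A \<le> measure (measure_pmf p \<bind> Q) A"
proof -
  have "pmf p k * measure (Q k) A = (\<integral>i. indicator {k} i * measure (Q k) A \<partial>measure_pmf p)"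
    by (simp add: measure_pmf_single)
  also have "\<dots> \<le> (\<integral>i. measure (Q i) A \<partial>measure_pmf p)"
    using Q(1) prob_space.prob_le_1
    by (intro integral_mono measure_pmf.integrable_const_bound[of _ 1])
       (auto simp: indicator_def)
  also have "\<dots> = measure (measure_pmf p \<bind> Q) A"
    by (rule measure_mixture[OF A, symmetric])
  finally show ?thesis .
qed

lemma absolutely_continuous_mixture:
  assumes "\<And>k. absolutely_continuous P (Q k)"
  shows "absolutely_continuous P (measure_pmf p \<bind> Q)"
  unfolding absolutely_continuous_def
proof
  fix N assume N: "N \<in> null_sets P"
  then have "emeasure (Q k) N = 0" for k
    using assms unfolding absolutely_continuous_def by blast
  then have "emeasure (measure_pmf p \<bind> Q) N = 0"
    using N by (subst emeasure_bind[OF _ mixture_kernel]) auto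
  then show "N \<in> null_sets (measure_pmf p \<bind> Q)"
    using N by (auto simp: null_sets_def sets_mixture)
qed

lemma mixture_absolutely_continuous:
  assumes "0 < pmf p k" and "absolutely_continuous (Q k) P"
  shows "absolutely_continuous (measure_pmf p \<bind> Q) P"
  unfolding absolutely_continuous_def
proof
  fix N assume N: "N \<in> null_sets (measure_pmf p \<bind> Q)"
  interpret Qk: prob_space "Q k" by (rule Q(1))
  have A: "N \<in> sets P" using N by (auto simp: null_sets_def sets_mixture)
  have "pmf p k * measure (Q k) N \<le> 0"
    using measure_mixture_ge[OF A, of k] N by (simp add: measure_def null_sets_def)
  then have "measure (Q k) N = 0"
    using assms(1) by (simp add: mult_le_0_iff order_antisym)
  then have "N \<in> null_sets (Q k)"
    using A Q(2) by (simp add: null_sets_def Qk.emeasure_eq_measure)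
  then show "N \<in> null_sets P" using assms(2) unfolding absolutely_continuous_def by blast
qed

text \<open>Integrability under each component would not by itself control an infinite mixture; the
  bound by \<open>a\<close>, common to all components, does.\<close>

lemma mixture_in_M_set:
  assumes "\<And>k. Q k \<in> M_set P F d S"
  shows "measure_pmf p \<bind> Q \<in> M_set P F d S"
proof -
  have ac: "absolutely_continuous P (Q k)" for k using assms unfolding M_set_def by blast
  show ?thesis
    unfolding M_set_iff[OF mixture_prob_space sets_mixture absolutely_continuous_mixture[OF ac]]
  proof (intro ballI allI impI)
    fix f a assume f: "f \<in> K_set P F d S" and a: "0 \<le> a" "AE x in P. - a \<le> f x"
    have "f \<in> borel_measurable P" using f by (simp add: K_set_def)
    then have "(\<integral>\<^sup>+x. ennreal (f x + a) \<partial>(measure_pmf p \<bind> Q)) = (\<integral>\<^sup>+k. \<integral>\<^sup>+x. ennreal (f x + a) \<partial>Q k \<partial>measure_pmf p)"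
      by (intro nn_integral_bind[OF _ mixture_kernel]) simp
    also have "\<dots> \<le> (\<integral>\<^sup>+k. ennreal a \<partial>measure_pmf p)"
      using assms f a M_set_iff[OF Q ac] by (intro nn_integral_mono) blast
    finally show "(\<integral>\<^sup>+x. ennreal (f x + a) \<partial>(measure_pmf p \<bind> Q)) \<le> ennreal a" by simp
  qed
qed

end

text \<open>If uniformity fails, violating events for the thresholds \<open>1 / Suc k\<close> can be
  picked at strictly increasing indices. Filling the other indices with the empty set gives a full
  sequence that contradicts contiguity.\<close>

lemma contiguous_uniform:
  assumes R: "contiguous R P" and \<epsilon>: "0 < \<epsilon>"
  shows "\<exists>\<eta>>0. eventually (\<lambda>n. \<forall>A\<in>sets (P n). measure (P n) A < \<eta> \<longrightarrow> measure (R n) A < \<epsilon>) sequentially"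
proof (rule ccontr)
  assume neg: "\<not> ?thesis"
  have "\<exists>n\<ge>N. \<exists>A\<in>sets (P n). measure (P n) A < \<eta> \<and> \<epsilon> \<le> measure (R n) A" if "0 < \<eta>" for \<eta> N
    using neg that unfolding eventually_sequentially by (meson not_less)
  then have "\<exists>n>N. \<exists>A\<in>sets (P n). measure (P n) A < 1 / Suc k \<and> \<epsilon> \<le> measure (R n) A" for N k
    by (metis Suc_le_eq of_nat_0_less_iff zero_less_Suc zero_less_divide_1_iff)
  then have step: "\<exists>n. N < n \<and> (\<exists>A\<in>sets (P n). measure (P n) A < 1 / Suc k \<and> \<epsilon> \<le> measure (R n) A)" for N k
    by blast
  obtain r :: "nat \<Rightarrow> nat" where
    r: "\<And>k. \<exists>A\<in>sets (P (r k)). measure (P (r k)) A < 1 / Suc k \<and> \<epsilon> \<le> measure (R (r k)) A" and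
    less: "\<And>k. r k < r (Suc k)"
    using dependent_nat_choice[of "\<lambda>k n. \<exists>A\<in>sets (P n). measure (P n) A < 1 / Suc k \<and> \<epsilon> \<le> measure (R n) A"
        "\<lambda>k n m. n < m"] step by blast
  have mono: "strict_mono r" using less by (rule strict_mono_Suc_iff[THEN iffD2, rule_format])
  obtain B where B: "\<And>k. B k \<in> sets (P (r k))" "\<And>k. measure (P (r k)) (B k) < 1 / Suc k"
    "\<And>k. \<epsilon> \<le> measure (R (r k)) (B k)"
    using r by metis
  define A where "A = (\<lambda>n. if n \<in> range r then B (the_inv r n) else {})"
  have inj: "inj r" by (rule strict_mono_imp_inj_on[OF mono])
  have Ar: "A (r k) = B k" for k unfolding A_def by (simp add: the_inv_f_f[OF inj])
  have "A n \<in> sets (P n)" for n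
    unfolding A_def using B(1) by (auto simp: the_inv_f_f[OF inj])
  moreover have "(\<lambda>n. measure (P n) (A n)) \<longlonglongrightarrow> 0"
  proof (rule LIMSEQ_I)
    fix e :: real assume "0 < e"
    then obtain K where K: "1 / Suc K < e" using nat_approx_posE by blast
    have "norm (measure (P n) (A n) - 0) < e" if n: "r K \<le> n" for n
    proof (cases "n \<in> range r")
      case True
      then obtain k where k: "n = r k" by blast
      then have "K \<le> k" using n strict_mono_less_eq[OF mono] by simp
      then have "1 / Suc k \<le> 1 / Suc K" by (simp add: frac_le)
      then show ?thesis using B(2)[of k] K unfolding k Ar by simp
    next
      case False
      then show ?thesis using \<open>0 < e\<close> by (simp add: A_def)
    qed
    then show "\<exists>N. \<forall>n\<ge>N. norm (measure (P n) (A n) - 0) < e" by blast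
  qed
  ultimately have "(\<lambda>n. measure (R n) (A n)) \<longlonglongrightarrow> 0"
    using R unfolding contiguous_def by blast
  then have "(\<lambda>k. measure (R (r k)) (A (r k))) \<longlonglongrightarrow> 0"
    using LIMSEQ_subseq_LIMSEQ[OF _ mono] by (auto simp: comp_def)
  then have "\<epsilon> \<le> 0"
    using B(3) Ar by (intro LIMSEQ_le_const) auto
  then show False using \<epsilon> by simp
qed

section \<open>The equivalence\<close>

lemma NAMFL_star_imp_separating_sequence:
  assumes market: "\<And>n. market_model (P n) (F n) (d n) (S n)"
    and Q0: "\<And>n. Q0 n \<in> M_set (P n) (F n) (d n) (S n)"
    and NA: "NAMFL_star U2 P F d S" and \<epsilon>: "0 < \<epsilon>" "\<epsilon> \<le> 1"
  shows "\<exists>Q. (\<forall>n. Q n \<in> M_set (P n) (F n) (d n) (S n)) \<and> contiguous Q P \<and>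
    (\<exists>\<eta>>0. eventually (\<lambda>n. \<forall>A\<in>sets (P n). \<epsilon> \<le> measure (P n) A \<longrightarrow> \<eta> \<le> measure (Q n) A) sequentially)"
proof -
  obtain \<delta> u R where \<delta>: "0 < \<delta>" and u: "u \<in> U2" and R: "\<And>n. R n \<in> equivalent_probs (P n)"
    and mc: "mutually_contiguous R P" and
    lim: "\<And>w. (\<And>n. w n \<in> D_set \<epsilon> (P n)) \<Longrightarrow>
      limsup (\<lambda>n. SUP f\<in>C_set (P n) (F n) (d n) (S n). ereal (\<integral>\<omega>. u (f \<omega> - w n \<omega>) \<partial>R n)) < ereal (u 0 - \<delta>)"
    using NA \<epsilon>(1) unfolding NAMFL_star_def by blast
  define G where "G = (\<lambda>n w. SUP f\<in>C_set (P n) (F n) (d n) (S n). ereal (\<integral>\<omega>. u (f \<omega> - w \<omega>) \<partial>R n))"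
  \<comment> \<open>The condition treats one sequence of claims at a time. Taking in each market a
    claim that violates the bound whenever some claim does makes a single sequence decide for all of
    D, so the bound becomes uniform for \<open>n \<ge> N\<close>.\<close>
  have "\<exists>w\<in>D_set \<epsilon> (P n). (\<exists>v\<in>D_set \<epsilon> (P n). \<not> G n v \<le> ereal (u 0 - \<delta>)) \<longrightarrow> \<not> G n w \<le> ereal (u 0 - \<delta>)" for n
    using one_in_D_set[OF market_modelD(1)[OF market] \<epsilon>(2), of n] by blast
  then obtain w where w: "\<And>n. w n \<in> D_set \<epsilon> (P n)" and
    bad: "\<And>n v. v \<in> D_set \<epsilon> (P n) \<Longrightarrow> \<not> G n v \<le> ereal (u 0 - \<delta>) \<Longrightarrow> \<not> G n (w n) \<le> ereal (u 0 - \<delta>)"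
    by metis
  have "limsup (\<lambda>n. G n (w n)) < ereal (u 0 - \<delta>)"
    unfolding G_def by (rule lim[OF w])
  then have "eventually (\<lambda>n. G n (w n) < ereal (u 0 - \<delta>)) sequentially"
    by (rule Limsup_lessD)
  then obtain N where N: "\<And>n. N \<le> n \<Longrightarrow> G n (w n) < ereal (u 0 - \<delta>)"
    unfolding eventually_sequentially by blast
  have bound: "(\<integral>\<omega>. u (f \<omega> - v \<omega>) \<partial>R n) \<le> u 0 - \<delta>"
    if n: "N \<le> n" and f: "f \<in> C_set (P n) (F n) (d n) (S n)" and v: "v \<in> D_set \<epsilon> (P n)" for n f v
  proof -
    have "ereal (\<integral>\<omega>. u (f \<omega> - v \<omega>) \<partial>R n) \<le> G n v"
      unfolding G_def using f by (rule SUP_upper)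
    also have "\<dots> \<le> ereal (u 0 - \<delta>)"
      using bad[OF v] N[OF n] by (meson less_imp_le)
    finally show ?thesis by simp
  qed
  have "\<exists>Q\<in>M_set (P n) (F n) (d n) (S n). N \<le> n \<longrightarrow>
    (\<forall>A\<in>sets (P n). \<epsilon> \<le> measure (P n) A \<longrightarrow> \<delta> / loss u 2 \<le> measure Q A) \<and>
    (\<forall>A\<in>sets (P n). \<forall>t>0. measure Q A \<le> (loss u 2 + loss u t * measure (R n) A) / (\<delta> * t))" for n
  \<comment> \<open>Below \<open>N\<close> no estimate is available, and the given martingale
    measure is used.\<close>
  proof (cases "N \<le> n")
    case True
    show ?thesis
      using market_separating_measure[OF market R u \<epsilon>(2) \<delta> bound[OF True]] by blast
  qed (use Q0 in blast)
  then have "\<forall>n. \<exists>Q. Q \<in> M_set (P n) (F n) (d n) (S n) \<and> (N \<le> n \<longrightarrow>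
    (\<forall>A\<in>sets (P n). \<epsilon> \<le> measure (P n) A \<longrightarrow> \<delta> / loss u 2 \<le> measure Q A) \<and>
    (\<forall>A\<in>sets (P n). \<forall>t>0. measure Q A \<le> (loss u 2 + loss u t * measure (R n) A) / (\<delta> * t)))"
    by blast
  from choice[OF this] obtain Q where M: "\<And>n. Q n \<in> M_set (P n) (F n) (d n) (S n)"
    and lower: "\<And>n A. N \<le> n \<Longrightarrow> A \<in> sets (P n) \<Longrightarrow> \<epsilon> \<le> measure (P n) A \<Longrightarrow> \<delta> / loss u 2 \<le> measure (Q n) A"
    and upper: "\<And>n A t. N \<le> n \<Longrightarrow> A \<in> sets (P n) \<Longrightarrow> 0 < t \<Longrightarrow>
      measure (Q n) A \<le> (loss u 2 + loss u t * measure (R n) A) / (\<delta> * t)"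
    by blast
  have "contiguous Q P"
    unfolding contiguous_def
  proof (intro allI impI)
    fix A assume A: "\<forall>n. A n \<in> sets (P n)" and "(\<lambda>n. measure (P n) (A n)) \<longlonglongrightarrow> 0"
    then have "(\<lambda>n. measure (R n) (A n)) \<longlonglongrightarrow> 0"
      using mc unfolding mutually_contiguous_def contiguous_def by blast
    then show "(\<lambda>n. measure (Q n) (A n)) \<longlonglongrightarrow> 0"
    proof (rule modulus_tendsto_zero[OF _ loss_nonneg \<delta> measure_nonneg])
      fix t :: real assume t: "0 < t"
      show "eventually (\<lambda>n. measure (Q n) (A n) \<le> (loss u 2 + loss u t * measure (R n) (A n)) / (\<delta> * t)) sequentially"
        using eventually_ge_at_top[of N] by eventually_elim (use upper A t in blast)
    qed
  qed
  \<comment> \<open>The modulus for the whole space at \<open>t = 2\<close> reads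
    \<open>1 \<le> loss u 2 / \<delta>\<close>; this excludes a zero denominator.\<close>
  moreover have "0 < \<delta> / loss u 2"
  proof -
    interpret Q: prob_space "Q N" using M[of N] by (simp add: M_set_def)
    have "sets (Q N) = sets (P N)" using M[of N] by (simp add: M_set_def)
    then have "1 \<le> (loss u 2 + loss u 2 * measure (R N) (space (P N))) / (\<delta> * 2)"
      using upper[of N "space (P N)" 2] Q.prob_space sets_eq_imp_space_eq[of "Q N" "P N"] by simp
    moreover have "measure (R N) (space (P N)) = 1"
      using equivalent_probsD(1,3)[OF R[of N]] prob_space.prob_space by metis
    ultimately show ?thesis using \<delta> by (simp add: field_simps)
  qed
  moreover have "eventually (\<lambda>n. \<forall>A\<in>sets (P n). \<epsilon> \<le> measure (P n) A \<longrightarrow> \<delta> / loss u 2 \<le> measure (Q n) A) sequentially"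
    using eventually_ge_at_top[of N] by eventually_elim (use lower in blast)
  ultimately show ?thesis using M by blast
qed

lemma NAMFL_star_imp_contiguous_martingale_measures:
  assumes market: "\<And>n. market_model (P n) (F n) (d n) (S n)"
    and ne: "\<And>n. M_set (P n) (F n) (d n) (S n) \<inter> equivalent_probs (P n) \<noteq> {}"
    and NA: "NAMFL_star U2 P F d S"
  shows "\<exists>Q. (\<forall>n. Q n \<in> M_set (P n) (F n) (d n) (S n) \<inter> equivalent_probs (P n)) \<and>
    mutually_contiguous Q P"
proof -
  obtain Q0 where Q0: "\<And>n. Q0 n \<in> M_set (P n) (F n) (d n) (S n)" "\<And>n. Q0 n \<in> equivalent_probs (P n)"
    using choice[of "\<lambda>n Q. Q \<in> M_set (P n) (F n) (d n) (S n) \<inter> equivalent_probs (P n)"] ne by blast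
  define sep where "sep = (\<lambda>k Q \<eta>. eventually (\<lambda>n. \<forall>A\<in>sets (P n).
    1 / Suc k \<le> measure (P n) A \<longrightarrow> \<eta> \<le> measure (Q n) A) sequentially)"
  have "\<exists>Q. (\<forall>n. Q n \<in> M_set (P n) (F n) (d n) (S n)) \<and> contiguous Q P \<and> (\<exists>\<eta>>0. sep k Q \<eta>)" for k
    unfolding sep_def by (rule NAMFL_star_imp_separating_sequence[OF market Q0(1) NA]) auto
  from choice[OF allI[OF this]] obtain Q1 where
    "\<forall>k. (\<forall>n. Q1 k n \<in> M_set (P n) (F n) (d n) (S n)) \<and> contiguous (Q1 k) P \<and> (\<exists>\<eta>>0. sep k (Q1 k) \<eta>)"
    by (rule exE)
  then have Q1: "\<And>k n. Q1 k n \<in> M_set (P n) (F n) (d n) (S n)" "\<And>k. contiguous (Q1 k) P"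
    and "\<forall>k. \<exists>\<eta>>0. sep k (Q1 k) \<eta>"
    by blast+
  from choice[OF this(3)] obtain \<eta> where "\<forall>k. 0 < \<eta> k \<and> sep k (Q1 k) (\<eta> k)"
    by (rule exE)
  then have \<eta>: "\<And>k. 0 < \<eta> k" "\<And>k. eventually (\<lambda>n. \<forall>A\<in>sets (P n).
      1 / Suc k \<le> measure (P n) A \<longrightarrow> \<eta> k \<le> measure (Q1 k n) A) sequentially"
    unfolding sep_def by blast+
  \<comment> \<open>The components with \<open>k \<ge> n\<close> are \<open>Q0 n\<close>, which makes the mixture equivalent to \<open>P n\<close>.\<close>
  define Q2 where "Q2 = (\<lambda>n k. if k < n then Q1 k n else Q0 n)"
  \<comment> \<open>Every index gets positive weight, so component \<open>k\<close> contributes a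
    share of the mixture that does not depend on \<open>n\<close>.\<close>
  define p :: "nat pmf" where "p = geometric_pmf (1 / 2)"
  have p: "0 < pmf p k" for k by (simp add: p_def)
  define Q where "Q = (\<lambda>n. measure_pmf p \<bind> Q2 n)"
  have Q2M: "Q2 n k \<in> M_set (P n) (F n) (d n) (S n)" for n k
    using Q0(1) Q1(1) by (simp add: Q2_def)
  then have Q2: "prob_space (Q2 n k)" "sets (Q2 n k) = sets (P n)" "absolutely_continuous (P n) (Q2 n k)" for n k
    unfolding M_set_def by blast+
  have M: "Q n \<in> M_set (P n) (F n) (d n) (S n)" for n
    unfolding Q_def by (rule mixture_in_M_set[OF Q2(1,2) Q2M])
  \<comment> \<open>\<open>k = n\<close> is the first index at which \<open>Q2 n\<close> takes the
    value \<open>Q0 n\<close>; one equivalent component makes the whole mixture equivalent.\<close>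
  have "absolutely_continuous (Q2 n n) (P n)" for n
    using equivalent_probsD(5)[OF Q0(2)] by (simp add: Q2_def)
  then have "absolutely_continuous (Q n) (P n)" for n
    unfolding Q_def by (rule mixture_absolutely_continuous[OF Q2(1,2) p])
  then have equiv: "Q n \<in> equivalent_probs (P n)" for n
    using M[of n] unfolding M_set_def equivalent_probs_def by blast
  have "contiguous Q P"
    unfolding contiguous_def
  proof (intro allI impI)
    fix A assume A: "\<forall>n. A n \<in> sets (P n)" and PA: "(\<lambda>n. measure (P n) (A n)) \<longlonglongrightarrow> 0"
    \<comment> \<open>For fixed \<open>k\<close> the component equals \<open>Q1 k n\<close> once
      \<open>n > k\<close>, so it inherits contiguity. The weights are then summed by dominated
      convergence.\<close>
    have "(\<lambda>n. measure (Q2 n k) (A n)) \<longlonglongrightarrow> 0" for k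
    proof (rule Lim_transform_eventually)
      show "(\<lambda>n. measure (Q1 k n) (A n)) \<longlonglongrightarrow> 0"
        using Q1(2) A PA unfolding contiguous_def by blast
      show "eventually (\<lambda>n. measure (Q1 k n) (A n) = measure (Q2 n k) (A n)) sequentially"
        using eventually_gt_at_top[of k] by eventually_elim (simp add: Q2_def)
    qed
    then have "(\<lambda>n. \<integral>k. measure (Q2 n k) (A n) \<partial>measure_pmf p) \<longlonglongrightarrow> (\<integral>k. 0 \<partial>measure_pmf p)"
      using prob_space.prob_le_1[OF Q2(1)]
      by (intro integral_dominated_convergence[where w = "\<lambda>_. 1"]) auto
    then show "(\<lambda>n. measure (Q n) (A n)) \<longlonglongrightarrow> 0"
      using A by (simp add: Q_def measure_mixture[OF Q2(1,2)])
  qed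
  moreover have "contiguous P Q"
    unfolding contiguous_def
  proof (intro allI impI)
    fix A assume "\<forall>n. A n \<in> sets (Q n)" and QA: "(\<lambda>n. measure (Q n) (A n)) \<longlonglongrightarrow> 0"
    then have A: "A n \<in> sets (P n)" for n using equivalent_probsD(2)[OF equiv[of n]] by blast
    show "(\<lambda>n. measure (P n) (A n)) \<longlonglongrightarrow> 0"
    proof (rule order_tendstoI)
      fix a :: real assume "a < 0"
      then show "eventually (\<lambda>n. a < measure (P n) (A n)) sequentially"
        by (intro always_eventually allI) (rule less_le_trans[OF _ measure_nonneg])
    next
      fix a :: real assume "0 < a"
      \<comment> \<open>Component \<open>k\<close> alone gives every event of
        \<open>P n\<close>-probability at least \<open>1 / Suc k\<close> mass
        \<open>\<eta> k\<close> for large \<open>n\<close>. Such an event has mixture probability at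
        least \<open>pmf p k * \<eta> k\<close>, which is impossible once the mixture probability of
        \<open>A n\<close> falls below this value.\<close>
      then obtain k where k: "1 / Suc k < a" using nat_approx_posE by blast
      have "eventually (\<lambda>n. measure (Q n) (A n) < pmf p k * \<eta> k) sequentially"
        using QA p \<eta>(1) by (intro order_tendstoD) auto
      then show "eventually (\<lambda>n. measure (P n) (A n) < a) sequentially"
        using \<eta>(2)[of k] eventually_gt_at_top[of k]
      proof eventually_elim
        case (elim n)
        have "pmf p k * measure (Q1 k n) (A n) \<le> measure (Q n) (A n)"
          using measure_mixture_ge[where Q = "Q2 n" and k = k and p = p, OF Q2(1,2) A] elim(3)
          unfolding Q_def by (simp add: Q2_def)
        also have "\<dots> < pmf p k * \<eta> k" by (rule elim(1))
        finally have "measure (Q1 k n) (A n) < \<eta> k" using p by simp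
        then have "measure (P n) (A n) < 1 / Suc k" using elim(2) A[of n] by force
        then show ?case using k by simp
      qed
    qed
  qed
  ultimately show ?thesis using M equiv unfolding mutually_contiguous_def by blast
qed

section \<open>From contiguous martingale measures to the utility bound\<close>

lemma D_set_measure_ge:
  assumes P: "prob_space P" and \<epsilon>: "0 \<le> \<epsilon>" and w: "w \<in> D_set \<epsilon> P"
  shows "\<epsilon> / 2 \<le> measure P {x \<in> space P. \<epsilon> / 2 \<le> w x}"
proof -
  interpret prob_space P by fact
  let ?A = "{x \<in> space P. \<epsilon> / 2 \<le> w x}"
  have [measurable]: "w \<in> borel_measurable P" and w01: "AE x in P. 0 \<le> w x \<and> w x \<le> 1"
    and ge: "\<epsilon> \<le> (\<integral>x. w x \<partial>P)"
    using w unfolding D_set_def L_infty_def by auto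
  have A: "?A \<in> sets P" by measurable
  \<comment> \<open>A reverse Markov estimate: \<open>w\<close> is at most 1 on the event and below
    \<open>\<epsilon> / 2\<close> off it, so at least half of the expectation \<epsilon> must come
    from the probability of the event.\<close>
  have "(\<integral>x. w x \<partial>P) \<le> (\<integral>x. indicator ?A x + \<epsilon> / 2 \<partial>P)"
  proof (rule integral_mono_AE)
    show "integrable P w"
      using w01 by (intro integrable_const_bound[of _ 1]) (auto elim: eventually_mono)
    show "integrable P (\<lambda>x. indicator ?A x + \<epsilon> / 2)"
      using A by (intro Bochner_Integration.integrable_add integrable_const)
        (simp add: emeasure_eq_measure)
    show "AE x in P. w x \<le> indicator ?A x + \<epsilon> / 2"
      using w01 AE_space by eventually_elim (use \<epsilon> in \<open>auto simp: indicator_def\<close>)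
  qed
  also have "\<dots> = measure P ?A + \<epsilon> / 2"
    using A by (subst Bochner_Integration.integral_add) (simp_all add: prob_space emeasure_eq_measure)
  finally show ?thesis using ge by simp
qed

lemma contiguous_martingale_measures_imp_NAMFL_star:
  assumes market: "\<And>n. market_model (P n) (F n) (d n) (S n)"
    and Q: "\<And>n. Q n \<in> M_set (P n) (F n) (d n) (S n)" "\<And>n. Q n \<in> equivalent_probs (P n)"
    and mc: "mutually_contiguous Q P"
  shows "NAMFL_star U2 P F d S"
  unfolding NAMFL_star_def
proof (intro allI impI)
  fix \<epsilon> :: real assume \<epsilon>: "0 < \<epsilon>"
  have "contiguous P Q" using mc unfolding mutually_contiguous_def by blast
  \<comment> \<open>The level \<open>\<epsilon> / 2\<close> matches \<open>D_set_measure_ge\<close>: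
    contrapositively, events of \<open>P n\<close>-probability at least
    \<open>\<epsilon> / 2\<close> have \<open>Q n\<close>-probability at least \<eta> for all large
    \<open>n\<close>.\<close>
  from contiguous_uniform[OF this, of "\<epsilon> / 2"] \<epsilon> obtain \<eta> where \<eta>: "0 < \<eta>" and
    ev: "eventually (\<lambda>n. \<forall>A\<in>sets (Q n). measure (Q n) A < \<eta> \<longrightarrow> measure (P n) A < \<epsilon> / 2) sequentially"
    by auto
  \<comment> \<open>The claim is at least \<open>\<epsilon> / 2\<close> on an event of
    \<open>Q n\<close>-probability \<eta>, so its expectation is at least
    \<open>\<epsilon> * \<eta> / 2 = 2 * \<delta>\<close>. The spare \<delta> makes the inequality
    for the limes superior strict.\<close>
  define \<delta> where "\<delta> = \<epsilon> * \<eta> / 4"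
  have \<delta>: "0 < \<delta>" using \<epsilon> \<eta> by (simp add: \<delta>_def)
  have u: "(\<lambda>x. x) \<in> U2"
    by (simp add: U2_def mono_def concave_on_iff)
  have key: "limsup (\<lambda>n. SUP f\<in>C_set (P n) (F n) (d n) (S n). ereal (\<integral>\<omega>. f \<omega> - w n \<omega> \<partial>Q n)) < ereal (0 - \<delta>)"
    if w: "\<And>n. w n \<in> D_set \<epsilon> (P n)" for w
  proof -
    have "eventually (\<lambda>n. (SUP f\<in>C_set (P n) (F n) (d n) (S n). ereal (\<integral>\<omega>. f \<omega> - w n \<omega> \<partial>Q n)) \<le> ereal (- (2 * \<delta>))) sequentially"
      using ev
    proof eventually_elim
      case (elim n)
      interpret Q: prob_space "Q n" using equivalent_probsD(1)[OF Q(2)] .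
      note QD = equivalent_probsD[OF Q(2)[of n]]
      let ?A = "{x \<in> space (P n). \<epsilon> / 2 \<le> w n x}"
      have wL: "w n \<in> L_infty (P n)" and "AE x in P n. 0 \<le> w n x \<and> w n x \<le> 1"
        using w[of n] unfolding D_set_def by auto
      then have w0: "AE x in Q n. 0 \<le> w n x"
        using absolutely_continuous_AE'[OF QD(2,4)] by (auto elim: eventually_mono)
      have "w n \<in> borel_measurable (P n)" using wL unfolding L_infty_def by blast
      then have A: "?A \<in> sets (Q n)" unfolding QD(2) by measurable
      have "\<eta> \<le> measure (Q n) ?A"
        using elim A D_set_measure_ge[OF market_modelD(1)[OF market] _ w[of n]] \<epsilon> by force
      then have "\<epsilon> / 2 * \<eta> \<le> \<epsilon> / 2 * measure (Q n) ?A" using \<epsilon> by simp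
      also have "\<dots> = (\<integral>x. \<epsilon> / 2 * indicator ?A x \<partial>Q n)" using A by simp
      also have "\<dots> \<le> (\<integral>x. w n x \<partial>Q n)"
      proof (rule integral_mono_AE)
        show "integrable (Q n) (w n)"
          using integrable_mono_L_infty[OF Q(2) _ wL, of "\<lambda>x. x"] by (simp add: mono_def)
        show "integrable (Q n) (\<lambda>x. \<epsilon> / 2 * indicator ?A x)"
          using A by (simp add: Q.emeasure_eq_measure)
        show "AE x in Q n. \<epsilon> / 2 * indicator ?A x \<le> w n x"
          using w0 by eventually_elim (auto simp: indicator_def)
      qed
      finally have wge: "2 * \<delta> \<le> (\<integral>x. w n x \<partial>Q n)" by (simp add: \<delta>_def)
      show ?case
      proof (rule SUP_least)
        fix f assume f: "f \<in> C_set (P n) (F n) (d n) (S n)"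
        note fi = M_set_C_set_integral[OF Q(1)[of n] Q(2)[of n] f]
        have "integrable (Q n) (w n)"
          using integrable_mono_L_infty[OF Q(2) _ wL, of "\<lambda>x. x"] by (simp add: mono_def)
        then show "ereal (\<integral>\<omega>. f \<omega> - w n \<omega> \<partial>Q n) \<le> ereal (- (2 * \<delta>))"
          using fi wge by simp
      qed
    qed
    then have "limsup (\<lambda>n. SUP f\<in>C_set (P n) (F n) (d n) (S n). ereal (\<integral>\<omega>. f \<omega> - w n \<omega> \<partial>Q n)) \<le> ereal (- (2 * \<delta>))"
      by (rule Limsup_bounded)
    also have "\<dots> < ereal (0 - \<delta>)" using \<delta> by simp
    finally show ?thesis .
  qed
  show "\<exists>\<delta>>0. \<exists>u\<in>U2. \<exists>R. (\<forall>n. R n \<in> equivalent_probs (P n)) \<and> mutually_contiguous R P \<and>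
      (\<forall>w. (\<forall>n. w n \<in> D_set \<epsilon> (P n)) \<longrightarrow>
         limsup (\<lambda>n. SUP f\<in>C_set (P n) (F n) (d n) (S n). ereal (\<integral>\<omega>. u (f \<omega> - w n \<omega>) \<partial>R n)) < ereal (u 0 - \<delta>))"
    using \<delta> u Q(2) mc key by (intro exI[of _ \<delta>] conjI bexI[of _ "\<lambda>x. x"] exI[of _ Q]) auto
qed

theorem theorem4p2:
  fixes P :: "nat \<Rightarrow> 'a measure"
    and F :: "nat \<Rightarrow> real \<Rightarrow> 'a measure"
    and d :: "nat \<Rightarrow> nat"
    and S :: "nat \<Rightarrow> real \<Rightarrow> 'a \<Rightarrow> nat \<Rightarrow> real"
  assumes "\<And>n. market_model (P n) (F n) (d n) (S n)"
    and "\<And>n. M_set (P n) (F n) (d n) (S n) \<inter> equivalent_probs (P n) \<noteq> {}"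
  shows "NAMFL_star U2 P F d S \<longleftrightarrow>
    (\<exists>Q. (\<forall>n. Q n \<in> M_set (P n) (F n) (d n) (S n) \<inter> equivalent_probs (P n)) \<and>
         mutually_contiguous Q P)"
proof
  show "\<exists>Q. (\<forall>n. Q n \<in> M_set (P n) (F n) (d n) (S n) \<inter> equivalent_probs (P n)) \<and>
      mutually_contiguous Q P" if "NAMFL_star U2 P F d S"
    using NAMFL_star_imp_contiguous_martingale_measures[OF assms that] .
  show "NAMFL_star U2 P F d S"
    if Q: "\<exists>Q. (\<forall>n. Q n \<in> M_set (P n) (F n) (d n) (S n) \<inter> equivalent_probs (P n)) \<and>
      mutually_contiguous Q P"
  proof -
    obtain Q where "\<forall>n. Q n \<in> M_set (P n) (F n) (d n) (S n) \<inter> equivalent_probs (P n)" "mutually_contiguous Q P"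
      using Q by blast
    then show ?thesis
      by (intro contiguous_martingale_measures_imp_NAMFL_star[where Q = Q] assms(1)) auto
  qed
qed

end
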